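(* Assume the setting in the context, suppose $\mathbb P$ has finite range of dependence, and suppose there is a non-random constant $C_*>0$ such that for $\mathcal P$-a.a. $\omega$, $c_{x,y}(\omega)\le C_*$ for all edges $\{x,y\}$ of $\mathrm{DT}(\hat\omega)$. Then Assumption SEP is satisfied.
   Context: $\mathcal N$ = locally finite subsets of $\mathbb R^d$, identified with counting measures ($\xi(A)=\#(\xi\cap A)$), $\sigma$-algebra generated by $\xi\mapsto\xi(A)$; $\tau_x\xi:=\xi-x$. $\mathrm{Vor}(x|\xi)=\{y:|y-x|\le|y-z|\ \forall z\in\xi\}$; $\mathrm{DT}(\xi)$ is the graph on $\xi$ with edges $\{x,y\}$, $x\ne y$, such that $\mathrm{Vor}(x|\xi)$ and $\mathrm{Vor}(y|\xi)$ share a $(d-1)$-dimensional face; write $x\sim y$. Setting: on a probability space $(\Omega,\mathcal F,\mathcal P)$ there is a simple point process $\omega\mapsto\hat\omega\in\mathcal N$ whose law $\mathbb P$ is stationary ($\mathbb P(\tau_xA)=\mathbb P(A)$ for all $x$) with finite intensity $\mathbb E[\xi([0,1]^d)]$; for each pair $x\sim y$ in $\mathrm{DT}(\hat\omega)$ there are non-negative values $c^{o}_{x,y}(\omega)$, $c^o_{y,x}(\omega)$, and $c_{x,y}(\omega):=c^o_{x,y}(\omega)+c^o_{y,x}(\omega)$. $\mathbb P$ has finite range of dependence if there is $L>0$ such that $\xi\cap A$ and $\xi\cap B$ are independent under $\mathbb P$ for all Borel $A,B\subset\mathbb R^d$ at Euclidean distance at least $L$. Assumption SEP: for $\mathcal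 P$-a.a. $\omega$ there exists $t_0=t_0(\omega)>0$ such that, if each edge $\{x,y\}$ of $\mathrm{DT}(\hat\omega)$ is kept independently with probability $1-e^{-t_0c_{x,y}(\omega)}$ (and erased otherwise), then almost surely the resulting undirected graph has only connected components of finite cardinality. *)

theory Defs
  imports "HOL-Probability.Probability"
begin

definition locfin :: "'a::euclidean_space set \<Rightarrow> bool" where
  "locfin \<xi> \<longleftrightarrow> (\<forall>K. compact K \<longrightarrow> finite (\<xi> \<inter> K))"

definition Nsp :: "'a::euclidean_space set set" where
  "Nsp = {\<xi>. locfin \<xi>}"

definition npts :: "'a set \<Rightarrow> 'a set \<Rightarrow> ennreal" where
  "npts \<xi> A = emeasure (count_space UNIV) (\<xi> \<inter> A)"

definition NN :: "'a::euclidean_space set measure" where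
  "NN = sigma Nsp {{\<xi> \<in> Nsp. npts \<xi> A = n} | A n. A \<in> sets borel}"

definition shift :: "'a::euclidean_space \<Rightarrow> 'a set \<Rightarrow> 'a set" where
  "shift x \<xi> = (\<lambda>y. y - x) ` \<xi>"

definition stationary :: "'a::euclidean_space set measure \<Rightarrow> bool" where
  "stationary P \<longleftrightarrow> (\<forall>x. \<forall>A \<in> sets NN. emeasure P (shift x ` A) = emeasure P A)"

definition finite_intensity :: "'a::euclidean_space set measure \<Rightarrow> bool" where
  "finite_intensity P \<longleftrightarrow> (\<integral>\<^sup>+ \<xi>. npts \<xi> (cbox 0 One) \<partial>P) < \<infinity>"

definition finite_range_dep :: "'a::euclidean_space set measure \<Rightarrow> bool" where
  "finite_range_dep P \<longleftrightarrow> (\<exists>L>0. \<forall>A B. A \<in> sets borel \<longrightarrow> B \<in> sets borel \<longrightarrow>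
      (\<forall>a\<in>A. \<forall>b\<in>B. L \<le> dist a b) \<longrightarrow>
      prob_space.indep_var P NN (\<lambda>\<xi>. \<xi> \<inter> A) NN (\<lambda>\<xi>. \<xi> \<inter> B))"

definition Vor :: "'a::euclidean_space \<Rightarrow> 'a set \<Rightarrow> 'a set" where
  "Vor x \<xi> = {y. \<forall>z\<in>\<xi>. dist y x \<le> dist y z}"

definition DT_edge :: "'a::euclidean_space set \<Rightarrow> 'a \<Rightarrow> 'a \<Rightarrow> bool" where
  "DT_edge \<xi> x y \<longleftrightarrow> x \<in> \<xi> \<and> y \<in> \<xi> \<and> x \<noteq> y \<and>
     (\<exists>F. F face_of Vor x \<xi> \<and> F face_of Vor y \<xi> \<and> aff_dim F = int DIM('a) - 1)"

definition DT_edges :: "'a::euclidean_space set \<Rightarrow> 'a set set" where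
  "DT_edges \<xi> = {{x, y} | x y. DT_edge \<xi> x y}"

definition cond :: "('w \<Rightarrow> 'a \<Rightarrow> 'a \<Rightarrow> real) \<Rightarrow> 'w \<Rightarrow> 'a \<Rightarrow> 'a \<Rightarrow> real" where
  "cond co \<omega> x y = co \<omega> x y + co \<omega> y x"

text \<open>Conductance of an unordered edge e = {x,y} (well defined since cond is symmetric).\<close>
definition edge_cond :: "('w \<Rightarrow> 'a \<Rightarrow> 'a \<Rightarrow> real) \<Rightarrow> 'w \<Rightarrow> 'a set \<Rightarrow> real" where
  "edge_cond co \<omega> e = (THE v. \<exists>x y. e = {x, y} \<and> x \<noteq> y \<and> v = cond co \<omega> x y)"

definition perc :: "'a::euclidean_space set \<Rightarrow> ('a set \<Rightarrow> real) \<Rightarrow> real \<Rightarrow> ('a set \<Rightarrow> bool) measure" where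
  "perc \<xi> w t = (\<Pi>\<^sub>M e\<in>DT_edges \<xi>. measure_pmf (bernoulli_pmf (1 - exp (- t * w e))))"

definition open_rel :: "'a::euclidean_space set \<Rightarrow> ('a set \<Rightarrow> bool) \<Rightarrow> ('a \<times> 'a) set" where
  "open_rel \<xi> \<eta> = {(x, y). DT_edge \<xi> x y \<and> \<eta> {x, y}}"

definition finite_clusters :: "'a::euclidean_space set \<Rightarrow> ('a set \<Rightarrow> bool) \<Rightarrow> bool" where
  "finite_clusters \<xi> \<eta> \<longleftrightarrow> (\<forall>x\<in>\<xi>. finite {y. (x, y) \<in> (open_rel \<xi> \<eta>)\<^sup>*})"

definition SEP :: "'w measure \<Rightarrow> ('w \<Rightarrow> 'a::euclidean_space set) \<Rightarrow> ('w \<Rightarrow> 'a \<Rightarrow> 'a \<Rightarrow> real) \<Rightarrow> bool" where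
  "SEP M hat co \<longleftrightarrow> (AE \<omega> in M. \<exists>t0>0.
      AE \<eta> in perc (hat \<omega>) (edge_cond co \<omega>) t0. finite_clusters (hat \<omega>) \<eta>)"

end

theory Submission
  imports Defs
begin

text \<open>Tile space by cells of side \<open>s\<close> and call a cell bad if some cell of the block around it is empty,
  if this block contains more than \<open>J\<close> points, or if an open edge has both endpoints in the block.
  An open edge is joined by a polygonal path through a common point of the two Voronoi cells which only
  meets bad cells, because points far from both endpoints are centres of large void balls. Hence an
  infinite cluster forces arbitrarily long chains of pairwise far apart bad cells. Given \<open>\<xi>\<close>, the probability of
  such a chain is at most the product of weights \<open>1\<close> (first two kinds of badness) and \<open>2\<^sup>J t C\<close> (an open
  edge); finite range of dependence makes the mean of this product small to the power of the length,
  which beats the number of chains once \<open>s\<close>, \<open>J\<close>, \<open>t\<close> are chosen in this order. The choice of \<open>s\<close>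
  needs \<open>P(\<xi> = {}) = 0\<close>; otherwise this probability is \<open>1\<close> and there is nothing to prove. Only the weights
  are integrated over \<open>\<xi>\<close>, so the conductances need not be measurable.\<close>

section \<open>Cells and blocks\<close>

text \<open>The sup norm fits cubic cells: on cell indices it counts cells, diagonal neighbours
  included.\<close>

definition near :: "real \<Rightarrow> 'a::euclidean_space \<Rightarrow> 'a \<Rightarrow> bool" where
  "near r z w \<longleftrightarrow> (\<forall>b\<in>Basis. \<bar>(z - w) \<bullet> b\<bar> \<le> r)"

definition grid :: "'a::euclidean_space set" where
  "grid = {z. \<forall>b\<in>Basis. z \<bullet> b \<in> \<int>}"

text \<open>The integer index of the half-open cube of side \<open>s\<close> containing
  \<open>x\<close>; the index lattice is the same for every \<open>s\<close>.\<close>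

definition cell :: "real \<Rightarrow> 'a::euclidean_space \<Rightarrow> 'a" where
  "cell s x = (\<Sum>b\<in>Basis. of_int \<lfloor>(x \<bullet> b) / s\<rfloor> *\<^sub>R b)"

text \<open>For a grid point \<open>z\<close>, taking \<open>k = 0\<close> gives the single cell
  \<open>z\<close>, so empty cells and crowded neighbourhoods are both events about blocks.\<close>

definition block :: "real \<Rightarrow> real \<Rightarrow> 'a::euclidean_space \<Rightarrow> 'a set" where
  "block s k z = {x. near k z (cell s x)}"

lemma cell_inner [simp]: "b \<in> Basis \<Longrightarrow> cell s x \<bullet> b = of_int \<lfloor>(x \<bullet> b) / s\<rfloor>"
  by (simp add: cell_def inner_sum_left_Basis)

lemma cell_in_grid [simp]: "cell s x \<in> grid"
  by (simp add: grid_def)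

lemma near_refl: "0 \<le> r \<Longrightarrow> near r z z"
  by (simp add: near_def)

lemma near_sym: "near r z w \<longleftrightarrow> near r w z"
  by (simp add: near_def inner_diff_left abs_minus_commute)

lemma near_trans:
  assumes "near r x y" "near r' y z"
  shows "near (r + r') x z"
  unfolding near_def
proof
  fix b :: 'a assume "b \<in> Basis"
  then have "\<bar>(x - y) \<bullet> b\<bar> \<le> r" "\<bar>(y - z) \<bullet> b\<bar> \<le> r'"
    using assms by (auto simp: near_def)
  then show "\<bar>(x - z) \<bullet> b\<bar> \<le> r + r'"
    by (simp add: inner_diff_left)
qed

lemma near_mono: "near r x y \<Longrightarrow> r \<le> r' \<Longrightarrow> near r' x y"
  unfolding near_def by (meson order_trans)

text \<open>Floors of two reals at distance at most an integer \<open>n\<close> differ by less than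
  \<open>n + 1\<close>, hence by at most \<open>n\<close>.\<close>

lemma near_cell:
  assumes "0 < s" "dist x y \<le> s * real n"
  shows "near (real n) (cell s x) (cell s y)"
  unfolding near_def
proof
  fix b :: 'a assume b: "b \<in> Basis"
  have "\<bar>(x - y) \<bullet> b\<bar> \<le> s * real n"
    using Basis_le_norm[OF b, of "x - y"] assms(2) by (simp add: dist_norm)
  then have "\<bar>(x - y) \<bullet> b\<bar> / s \<le> real n"
    using assms(1) by (simp add: pos_divide_le_eq mult.commute)
  then have "\<bar>(x \<bullet> b) / s - (y \<bullet> b) / s\<bar> \<le> real n"
    using assms(1) by (simp add: inner_diff_left diff_divide_distrib[symmetric])
  then have "\<bar>\<lfloor>(x \<bullet> b) / s\<rfloor> - \<lfloor>(y \<bullet> b) / s\<rfloor>\<bar> \<le> int n"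
    by linarith
  then have "real_of_int \<bar>\<lfloor>(x \<bullet> b) / s\<rfloor> - \<lfloor>(y \<bullet> b) / s\<rfloor>\<bar> \<le> real n"
    by (metis of_int_le_iff of_int_of_nat_eq)
  then show "\<bar>(cell s x - cell s y) \<bullet> b\<bar> \<le> real n"
    using b by (simp add: inner_diff_left)
qed

lemma dist_same_cell:
  fixes x y :: "'a::euclidean_space"
  assumes "0 < s" "cell s x = cell s y"
  shows "dist x y \<le> s * real DIM('a)"
proof -
  have "\<bar>(x - y) \<bullet> b\<bar> \<le> s" if b: "b \<in> Basis" for b
  proof -
    have "\<lfloor>(x \<bullet> b) / s\<rfloor> = \<lfloor>(y \<bullet> b) / s\<rfloor>"
      using arg_cong[OF assms(2), of "\<lambda>v. v \<bullet> b"] b by simp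
    then have "\<bar>(x \<bullet> b) / s - (y \<bullet> b) / s\<bar> \<le> 1"
      by linarith
    then have "\<bar>(x - y) \<bullet> b\<bar> / s \<le> 1"
      using assms(1) by (simp add: inner_diff_left diff_divide_distrib[symmetric])
    then show ?thesis
      using assms(1) by (simp add: pos_divide_le_eq)
  qed
  then have "(\<Sum>b\<in>Basis. \<bar>(x - y) \<bullet> b\<bar>) \<le> (\<Sum>b\<in>(Basis::'a set). s)"
    by (intro sum_mono)
  then show ?thesis
    using norm_le_l1[of "x - y"] by (simp add: dist_norm mult.commute)
qed

lemma grid_near_0_iff:
  assumes "z \<in> grid" "w \<in> grid"
  shows "near 0 z w \<longleftrightarrow> z = w"
  by (auto simp: near_def inner_diff_left intro: euclidean_eqI)

lemma block_0: "z \<in> grid \<Longrightarrow> block s 0 z = {x. cell s x = z}"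
  by (auto simp: block_def grid_near_0_iff)

lemma block_subset_block: "near k z z' \<Longrightarrow> block s 0 z' \<subseteq> block s k z"
  unfolding block_def using near_trans[of k z z' 0] by auto

text \<open>Points closer than \<open>s\<close> have cells within 1, which would put
  \<open>z\<close> and \<open>z'\<close> within \<open>k + 1 + k\<close>. For
  \<open>s \<ge> L\<close> such blocks therefore see independent parts of the process.\<close>

lemma far_blocks:
  assumes "0 < s" "\<not> near (2 * k + 1) z z'" "x \<in> block s k z" "y \<in> block s k z'"
  shows "s \<le> dist x y"
proof (rule ccontr)
  assume "\<not> s \<le> dist x y"
  then have "near 1 (cell s x) (cell s y)"
    using near_cell[of s x y 1] assms(1) by simp
  moreover have "near k z (cell s x)" "near k (cell s y) z'"
    using assms by (auto simp: block_def near_sym)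
  ultimately have "near (k + 1 + k) z z'"
    by (blast intro: near_trans)
  then show False
    using assms(2) by (simp add: algebra_simps)
qed

lemma bounded_block:
  fixes z :: "'a::euclidean_space"
  assumes "0 < s"
  shows "bounded (block s k z)"
proof -
  have "block s k z \<subseteq> cbox (s *\<^sub>R (z - k *\<^sub>R One)) (s *\<^sub>R (z + (k + 1) *\<^sub>R One))"
  proof
    fix x assume x: "x \<in> block s k z"
    have "s * (z \<bullet> b - k) \<le> x \<bullet> b \<and> x \<bullet> b \<le> s * (z \<bullet> b + (k + 1))" if b: "b \<in> Basis" for b
    proof -
      have "\<bar>z \<bullet> b - of_int \<lfloor>(x \<bullet> b) / s\<rfloor>\<bar> \<le> k"
        using x b by (auto simp: block_def near_def inner_diff_left)
      then have "z \<bullet> b - k \<le> (x \<bullet> b) / s" "(x \<bullet> b) / s \<le> z \<bullet> b + (k + 1)"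
        by linarith+
      then show ?thesis
        using assms by (simp add: pos_divide_le_eq pos_le_divide_eq mult.commute)
    qed
    then show "x \<in> cbox (s *\<^sub>R (z - k *\<^sub>R One)) (s *\<^sub>R (z + (k + 1) *\<^sub>R One))"
      by (simp add: mem_box algebra_simps)
  qed
  then show ?thesis
    using bounded_cbox bounded_subset by blast
qed

lemma finite_Int_bounded:
  assumes "locfin \<xi>" "bounded B"
  shows "finite (\<xi> \<inter> B)"
proof -
  have "finite (\<xi> \<inter> closure B)"
    using assms by (simp add: locfin_def)
  then show ?thesis
    by (rule rev_finite_subset) (use closure_subset in blast)
qed

lemma block_measurable [measurable]: "block s k z \<in> sets borel"
proof -
  have "block s k z = {x \<in> space borel. \<forall>b\<in>Basis. \<bar>z \<bullet> b - of_int \<lfloor>(x \<bullet> b) / s\<rfloor>\<bar> \<le> k}"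
    by (auto simp: block_def near_def inner_diff_left)
  also have "\<dots> \<in> sets borel"
    by measurable
  finally show ?thesis .
qed

lemma inj_on_coordinates: "inj_on (\<lambda>z. \<lambda>b\<in>Basis. z \<bullet> b) (A :: 'a::euclidean_space set)"
  by (rule inj_onI) (metis euclidean_eqI restrict_apply')

lemma countable_grid: "countable (grid :: 'a::euclidean_space set)"
proof (rule countable_image_inj_on)
  have "countable (PiE (Basis :: 'a set) (\<lambda>_. \<int> :: real set))"
    by (intro countable_PiE) (auto simp: Ints_def)
  then show "countable ((\<lambda>z. \<lambda>b\<in>Basis. z \<bullet> b) ` (grid :: 'a set))"
    by (rule countable_subset[rotated]) (auto simp: grid_def)
qed (rule inj_on_coordinates)

lemma finite_grid_near: "finite {w \<in> grid. near r (z :: 'a::euclidean_space) w}"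
proof (rule finite_imageD)
  have "finite (PiE (Basis :: 'a set) (\<lambda>b. {a \<in> \<int>. \<bar>z \<bullet> b - a\<bar> \<le> r}))"
  proof (intro finite_PiE)
    fix b :: 'a assume "b \<in> Basis"
    have "{a \<in> \<int>. \<bar>z \<bullet> b - a\<bar> \<le> r} \<subseteq> {a \<in> \<int>. z \<bullet> b - r \<le> a \<and> a \<le> z \<bullet> b + r}"
      by auto
    then show "finite {a \<in> \<int>. \<bar>z \<bullet> b - a\<bar> \<le> r}"
      by (rule finite_subset) (rule finite_int_segment)
  qed simp
  then show "finite ((\<lambda>z. \<lambda>b\<in>Basis. z \<bullet> b) ` {w \<in> grid. near r z w})"
    by (rule finite_subset[rotated]) (auto simp: grid_def near_def inner_diff_left)
qed (rule inj_on_coordinates)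

lemma card_grid_near:
  fixes z :: "'a::euclidean_space"
  assumes "z \<in> grid"
  shows "card {w \<in> grid. near r z w} = card {w \<in> grid. near r (0 :: 'a) w}"
proof -
  have "{w \<in> grid. near r z w} = (\<lambda>w. w + z) ` {w \<in> grid. near r 0 w}"
  proof (intro equalityI subsetI)
    fix w assume w: "w \<in> {w \<in> grid. near r z w}"
    then have "w - z \<in> {w \<in> grid. near r 0 w}"
      using assms by (auto simp: grid_def near_def inner_diff_left)
    then show "w \<in> (\<lambda>w. w + z) ` {w \<in> grid. near r 0 w}"
      by (metis (no_types, lifting) diff_add_cancel image_eqI)
  qed (use assms in \<open>auto simp: grid_def near_def inner_diff_left inner_add_left\<close>)
  then show ?thesis
    by (simp add: card_image)
qed

lemma cell_diff:
  assumes "0 < s" "z \<in> grid"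
  shows "cell s (x - s *\<^sub>R z) = cell s x - z"
proof (rule euclidean_eqI)
  fix b :: 'a assume b: "b \<in> Basis"
  then obtain i where i: "z \<bullet> b = of_int i"
    using assms(2) by (auto simp: grid_def elim: Ints_cases)
  have "((x - s *\<^sub>R z) \<bullet> b) / s = (x \<bullet> b) / s - of_int i"
    using assms(1) i by (simp add: inner_diff_left diff_divide_distrib)
  then show "cell s (x - s *\<^sub>R z) \<bullet> b = (cell s x - z) \<bullet> b"
    using b i by (simp add: inner_diff_left)
qed

text \<open>Lets stationarity reduce probabilities for any block to those for the block at the
  origin.\<close>

lemma block_translate:
  assumes "0 < s" "z \<in> grid"
  shows "{x. x - s *\<^sub>R z \<in> block s k 0} = block s k z"
  unfolding block_def mem_Collect_eq cell_diff[OF assms] near_def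
  by (simp add: inner_diff_left)

section \<open>Chains of far apart cells\<close>

text \<open>Chains are kept as sets, since only products of weights over their cells are used.
  Consecutive cells are within \<open>m + 1\<close>, which bounds the number of chains; all pairs
  are more than \<open>m\<close> apart, which gives independence.\<close>

fun far_chains :: "real \<Rightarrow> nat \<Rightarrow> 'a::euclidean_space \<Rightarrow> 'a set set" where
  "far_chains m 0 z = {{z}}"
| "far_chains m (Suc n) z =
     (\<Union>w\<in>{w \<in> grid. near (m + 1) z w}. insert z ` {C \<in> far_chains m n w. \<forall>c\<in>C. \<not> near m z c})"

lemma far_chainsD:
  assumes "0 \<le> m" "z \<in> grid" "C \<in> far_chains m n z"
  shows "finite C \<and> card C = Suc n \<and> C \<subseteq> grid \<and> pairwise (\<lambda>a b. \<not> near m a b) C"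
  using assms(2,3)
proof (induction n arbitrary: z C)
  case (Suc n)
  then obtain w D where D: "w \<in> grid" "D \<in> far_chains m n w" "C = insert z D" "\<forall>c\<in>D. \<not> near m z c"
    by auto
  have "z \<notin> D"
    using D(4) near_refl[OF assms(1)] by blast
  with Suc.IH[OF D(1,2)] Suc.prems(1) D(3,4) show ?case
    by (auto simp: pairwise_insert near_sym)
qed auto

lemma finite_far_chains: "finite (far_chains m n z)"
  by (induction n arbitrary: z) (auto simp: finite_grid_near)

text \<open>Each of the \<open>n\<close> steps chooses the next cell in a translate of one fixed
  finite box.\<close>

lemma card_far_chains:
  fixes z :: "'a::euclidean_space"
  assumes "z \<in> grid"
  shows "card (far_chains m n z) \<le> card {w \<in> grid. near (m + 1) (0 :: 'a) w} ^ n"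
  using assms
proof (induction n arbitrary: z)
  case (Suc n)
  let ?K = "card {w \<in> grid. near (m + 1) (0 :: 'a) w}"
  have "card (far_chains m (Suc n) z) \<le>
      (\<Sum>w\<in>{w \<in> grid. near (m + 1) z w}. card (insert z ` {C \<in> far_chains m n w. \<forall>c\<in>C. \<not> near m z c}))"
    by (simp add: card_UN_le finite_grid_near)
  also have "\<dots> \<le> (\<Sum>w\<in>{w \<in> grid. near (m + 1) z w}. ?K ^ n)"
  proof (rule sum_mono)
    fix w assume "w \<in> {w \<in> grid. near (m + 1) z w}"
    have "card (insert z ` {C \<in> far_chains m n w. \<forall>c\<in>C. \<not> near m z c})
        \<le> card {C \<in> far_chains m n w. \<forall>c\<in>C. \<not> near m z c}"
      by (rule card_image_le) (simp add: finite_far_chains)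
    also have "\<dots> \<le> card (far_chains m n w)"
      by (intro card_mono finite_far_chains) auto
    also have "\<dots> \<le> ?K ^ n"
      using \<open>w \<in> _\<close> by (intro Suc.IH) auto
    finally show "card (insert z ` {C \<in> far_chains m n w. \<forall>c\<in>C. \<not> near m z c}) \<le> ?K ^ n" .
  qed
  also have "\<dots> = ?K ^ Suc n"
    using card_grid_near[OF Suc.prems] by simp
  finally show ?case .
qed simp

text \<open>Diagonal neighbours count, because a segment may pass through a corner; so do steps that
  stay in one cell.\<close>

definition adj :: "'a::euclidean_space set \<Rightarrow> ('a \<times> 'a) set" where
  "adj S = {(a, b). a \<in> S \<and> b \<in> S \<and> near 1 a b}"

text \<open>The cell \<open>w\<close> is the one entered at the last exit of the path from the \<open>m\<close>-neighbourhood
  of \<open>z\<close>; the rest of the path then stays away from that neighbourhood.\<close>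

lemma last_exit:
  assumes "(y, v) \<in> (adj S)\<^sup>*" "\<not> near m z v" "near m z y"
  shows "\<exists>w\<in>S. near (m + 1) z w \<and> (w, v) \<in> (adj (S - {c. near m z c}))\<^sup>*"
proof -
  \<comment> \<open>Strengthened for induction backwards from \<open>v\<close>: either the path has
    stayed outside the neighbourhood so far, or its last exit has been found.\<close>
  have "(\<not> near m z y \<and> (y, v) \<in> (adj (S - {c. near m z c}))\<^sup>*) \<or>
      (\<exists>w\<in>S. near (m + 1) z w \<and> (w, v) \<in> (adj (S - {c. near m z c}))\<^sup>*)"
    using assms(1)
  proof (induction rule: converse_rtrancl_induct)
    case base
    then show ?case using assms(2) by simp
  next
    case (step y y')
    then consider "near m z y" "\<not> near m z y'" "(y', v) \<in> (adj (S - {c. near m z c}))\<^sup>*"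
      | "\<not> near m z y" "\<not> near m z y'" "(y', v) \<in> (adj (S - {c. near m z c}))\<^sup>*"
      | "\<exists>w\<in>S. near (m + 1) z w \<and> (w, v) \<in> (adj (S - {c. near m z c}))\<^sup>*"
      by blast
    then show ?case
    proof cases
      case 1
      then have "near (m + 1) z y'" "y' \<in> S"
        using step.hyps(1) by (auto simp: adj_def intro: near_trans)
      then show ?thesis using 1 by blast
    next
      case 2
      then have "(y, y') \<in> adj (S - {c. near m z c})"
        using step.hyps(1) by (auto simp: adj_def)
      then show ?thesis
        using 2 by (meson converse_rtrancl_into_rtrancl)
    qed blast
  qed
  then show ?thesis
    using assms(3) by blast
qed

text \<open>Iterates the last exit. Each round moves the start by at most \<open>m + 1\<close> and
  deletes the neighbourhood just left, so later cells stay far from earlier ones; the radius ensures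
  that \<open>v\<close> is still outside after every round.\<close>

lemma chain_in_connected_set:
  assumes "0 \<le> m" "S \<subseteq> grid" "z \<in> S" "(z, v) \<in> (adj S)\<^sup>*" "\<not> near ((m + 1) * real n + m) z v"
  shows "\<exists>C\<in>far_chains m n z. C \<subseteq> S"
  using assms(2-)
proof (induction n arbitrary: S z)
  case (Suc n)
  have "\<not> near m z v"
    using Suc.prems(4) assms(1) near_mono[of m z v "(m + 1) * real (Suc n) + m"] by auto
  then obtain w where w: "w \<in> S" "near (m + 1) z w" "(w, v) \<in> (adj (S - {c. near m z c}))\<^sup>*"
    using last_exit[OF Suc.prems(3)] near_refl[OF assms(1)] by blast
  have far: "\<not> near ((m + 1) * real n + m) w v"
  proof
    assume "near ((m + 1) * real n + m) w v"
    from near_trans[OF w(2) this] show False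
      using Suc.prems(4) by (simp add: algebra_simps)
  qed
  \<comment> \<open>A trivial remaining path means \<open>w = v\<close>, which is far from
    \<open>z\<close>; otherwise its first step already lies in the reduced set.\<close>
  have "w \<in> S - {c. near m z c}"
    using w(3)
  proof (cases rule: converse_rtranclE)
    case base
    then show ?thesis using w(1) \<open>\<not> near m z v\<close> by simp
  qed (auto simp: adj_def)
  from Suc.IH[OF _ this w(3) far] Suc.prems(1)
  obtain C where "C \<in> far_chains m n w" "C \<subseteq> S - {c. near m z c}"
    by blast
  moreover have "w \<in> grid"
    using w(1) Suc.prems(1) by blast
  ultimately have "insert z C \<in> far_chains m (Suc n) z" "insert z C \<subseteq> S"
    using w(2) Suc.prems(2) by auto
  then show ?case by blast
qed simp

text \<open>Cut the segment into pieces of length at most \<open>s\<close>; consecutive cut points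
  lie in equal or neighbouring cells.\<close>

lemma segment_cells_connected:
  assumes "0 < s" "\<And>u. u \<in> closed_segment p q \<Longrightarrow> cell s u \<in> S"
  shows "(cell s p, cell s q) \<in> (adj S)\<^sup>*"
proof -
  obtain N where N: "0 < N" "dist p q \<le> s * real N"
  proof -
    obtain N0 where "dist p q / s \<le> real N0"
      using real_arch_simple by blast
    then have "dist p q \<le> s * real (Suc N0)"
      using assms(1) by (simp add: pos_divide_le_eq algebra_simps)
    then show ?thesis using that by blast
  qed
  define u where "u i = p + (real i / real N) *\<^sub>R (q - p)" for i
  have seg: "u i \<in> closed_segment p q" if "i \<le> N" for i
    using N(1) that unfolding u_def closed_segment_def
    by (auto intro!: exI[of _ "real i / real N"] simp: algebra_simps)
  have "i \<le> N \<Longrightarrow> (cell s p, cell s (u i)) \<in> (adj S)\<^sup>*" for i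
  proof (induction i)
    case (Suc i)
    have "u (Suc i) - u i = (1 / real N) *\<^sub>R (q - p)"
      by (simp add: u_def algebra_simps add_divide_distrib)
    then have "dist (u i) (u (Suc i)) = dist p q / real N"
      by (metis abs_of_nonneg dist_commute dist_norm divide_inverse_commute inverse_eq_divide
          norm_scaleR of_nat_0_le_iff zero_le_divide_1_iff)
    also have "\<dots> \<le> s * real 1"
      using N by (simp add: pos_divide_le_eq)
    finally have "near 1 (cell s (u i)) (cell s (u (Suc i)))"
      using near_cell[OF assms(1), of "u i" "u (Suc i)" 1] by simp
    then have "(cell s (u i), cell s (u (Suc i))) \<in> adj S"
      using seg[of i] seg[of "Suc i"] Suc.prems assms(2) by (simp add: adj_def)
    then show ?case
      using Suc by (meson Suc_leD rtrancl.rtrancl_into_rtrancl)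
  qed (simp add: u_def)
  from this[of N] show ?thesis
    using N(1) by (simp add: u_def)
qed

section \<open>Bad cells and open clusters\<close>

lemma DT_edgeD: "DT_edge \<xi> x y \<Longrightarrow> x \<in> \<xi> \<and> y \<in> \<xi> \<and> x \<noteq> y"
  by (simp add: DT_edge_def)

lemma DT_edge_sym: "DT_edge \<xi> x y \<longleftrightarrow> DT_edge \<xi> y x"
  by (auto simp: DT_edge_def)

text \<open>The shared face has dimension \<open>d - 1 \<ge> 0\<close>, while the empty set has
  dimension -1, so the face contains a point.\<close>

lemma DT_edge_common_point:
  assumes "DT_edge \<xi> x y"
  obtains u where "\<And>z. z \<in> \<xi> \<Longrightarrow> dist u x \<le> dist u z" "\<And>z. z \<in> \<xi> \<Longrightarrow> dist u y \<le> dist u z"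
proof -
  obtain F where F: "F face_of Vor x \<xi>" "F face_of Vor y \<xi>" "aff_dim F = int DIM('a) - 1"
    using assms by (auto simp: DT_edge_def)
  have "(0::int) \<le> int DIM('a) - 1"
    by (simp add: Suc_leI)
  then have "F \<noteq> {}"
    using F(3) by force
  then obtain u where "u \<in> F"
    by blast
  then have "u \<in> Vor x \<xi>" "u \<in> Vor y \<xi>"
    using F(1,2) face_of_imp_subset by blast+
  then show ?thesis
    by (intro that[of u]) (simp_all add: Vor_def)
qed

text \<open>The part of badness decided by \<open>\<xi>\<close> alone, and only by its points in the
  block around \<open>z\<close>.\<close>

definition geobad :: "real \<Rightarrow> real \<Rightarrow> nat \<Rightarrow> 'a::euclidean_space set \<Rightarrow> 'a \<Rightarrow> bool" where
  "geobad s k J \<xi> z \<longleftrightarrow>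
     (\<exists>z'\<in>{z' \<in> grid. near k z z'}. \<xi> \<inter> block s 0 z' = {}) \<or> J < card (\<xi> \<inter> block s k z)"

definition block_edges :: "real \<Rightarrow> real \<Rightarrow> 'a::euclidean_space set \<Rightarrow> 'a \<Rightarrow> 'a set set" where
  "block_edges s k \<xi> z = {e \<in> DT_edges \<xi>. e \<subseteq> block s k z}"

definition bad :: "real \<Rightarrow> real \<Rightarrow> nat \<Rightarrow> 'a::euclidean_space set \<Rightarrow> ('a set \<Rightarrow> bool) \<Rightarrow> 'a \<Rightarrow> bool" where
  "bad s k J \<xi> \<eta> z \<longleftrightarrow> geobad s k J \<xi> z \<or> (\<exists>e\<in>block_edges s k \<xi> z. \<eta> e)"

definition bad_cells :: "real \<Rightarrow> real \<Rightarrow> nat \<Rightarrow> 'a::euclidean_space set \<Rightarrow> ('a set \<Rightarrow> bool) \<Rightarrow> 'a set" where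
  "bad_cells s k J \<xi> \<eta> = {z \<in> grid. bad s k J \<xi> \<eta> z}"

text \<open>Every point \<open>p\<close> of the segment from \<open>x\<close> to the common Voronoi point \<open>u\<close> is the centre of an
  open ball of radius \<open>dist p x\<close> without points of \<open>\<xi>\<close>. If \<open>u\<close> is far from \<open>x\<close>, such a ball contains
  a whole cell; otherwise \<open>x\<close> and \<open>y\<close> both lie in the block around the cell of \<open>p\<close>.\<close>

lemma bad_on_segment:
  fixes \<xi> :: "'a::euclidean_space set"
  assumes s: "0 < s" and e: "DT_edge \<xi> x y" "\<eta> {x, y}"
    and ux: "\<And>z. z \<in> \<xi> \<Longrightarrow> dist u x \<le> dist u z" and uy: "dist u y = dist u x"
    and p: "p \<in> closed_segment x u"
  shows "cell s p \<in> bad_cells s (real (2 * DIM('a) + 2)) J \<xi> \<eta>"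
proof -
  \<comment> \<open>\<open>\<rho>\<close> exceeds the bound \<open>s * DIM\<close> on the diameter
    of a cell, and \<open>k\<close> is such that points within \<open>2 * \<rho>\<close> have cells
    within \<open>k\<close>.\<close>
  define k where "k = real (2 * DIM('a) + 2)"
  define \<rho> where "\<rho> = s * real (DIM('a) + 1)"
  have \<rho>: "s * real DIM('a) < \<rho>" "0 < \<rho>" "2 * \<rho> = s * k"
  proof -
    show "s * real DIM('a) < \<rho>" "0 < \<rho>"
      unfolding \<rho>_def by (rule mult_strict_left_mono mult_pos_pos; simp add: s)+
    have "2 * real (DIM('a) + 1) = k"
      by (simp add: k_def)
    then show "2 * \<rho> = s * k"
      unfolding \<rho>_def by (metis mult.left_commute)
  qed
  have near_2\<rho>: "near k (cell s a) (cell s b)" if "dist a b \<le> 2 * \<rho>" for a b :: 'a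
    unfolding k_def by (rule near_cell[OF s]) (use that \<rho>(3) in \<open>simp only: k_def\<close>)
  have on_seg: "dist u x = dist u p' + dist p' x" if "p' \<in> closed_segment x u" for p'
    using that unfolding between_mem_segment[symmetric] between by (simp add: dist_commute)
  \<comment> \<open>A point of \<open>\<xi>\<close> in the cell of \<open>p'\<close> would be closer
    to \<open>u\<close> than \<open>x\<close> is, since it is closer to \<open>p'\<close> than
    \<open>x\<close> is.\<close>
  have empty: "\<xi> \<inter> block s 0 (cell s p') = {}" if p': "p' \<in> closed_segment x u" "\<rho> \<le> dist p' x" for p'
  proof (rule ccontr)
    assume "\<xi> \<inter> block s 0 (cell s p') \<noteq> {}"
    then obtain z where z: "z \<in> \<xi>" "cell s z = cell s p'"
      by (auto simp: block_0)
    have "dist p' z \<le> s * real DIM('a)"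
      using dist_same_cell[OF s] z(2) by metis
    moreover have "dist u x \<le> dist u p' + dist p' z"
      using ux[OF z(1)] dist_triangle[of u z p'] by linarith
    ultimately show False
      using on_seg[OF p'(1)] p'(2) \<rho>(1) by linarith
  qed
  have "bad s k J \<xi> \<eta> (cell s p)"
  proof (cases "\<rho> \<le> dist u x")
    case True
    \<comment> \<open>Take \<open>p\<close> itself if it is far from \<open>x\<close>, otherwise the
      point of the segment at distance exactly \<open>\<rho>\<close> from \<open>x\<close>.\<close>
    obtain p' where p': "p' \<in> closed_segment x u" "\<rho> \<le> dist p' x" "dist p p' \<le> 2 * \<rho>"
    proof (cases "\<rho> \<le> dist p x")
      case True
      then show ?thesis using that[OF p] \<rho>(2) by simp
    next
      case False
      define p' where "p' = x + (\<rho> / dist u x) *\<^sub>R (u - x)"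
      have pos: "0 < dist u x"
        using True \<rho>(2) by linarith
      have "p' \<in> closed_segment x u"
        using True pos \<rho>(2) unfolding p'_def closed_segment_def
        by (auto intro!: exI[of _ "\<rho> / dist u x"] simp: algebra_simps)
      moreover have "dist p' x = \<rho>"
        using pos \<rho>(2) by (simp add: p'_def dist_norm)
      moreover have "dist p p' \<le> dist p x + dist p' x"
        by (rule dist_triangle2)
      ultimately show ?thesis
        using that[of p'] False by linarith
    qed
    then have "near k (cell s p) (cell s p')" "\<xi> \<inter> block s 0 (cell s p') = {}"
      using near_2\<rho> empty by auto
    then show ?thesis
      by (auto simp: bad_def geobad_def)
  next
    case False
    \<comment> \<open>Here \<open>u\<close> is within \<open>\<rho>\<close> of both endpoints, so
      the detour from \<open>p\<close> over \<open>u\<close> reaches \<open>y\<close> within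
      \<open>2 * \<rho>\<close>.\<close>
    have "dist p x \<le> 2 * \<rho>" "dist p y \<le> 2 * \<rho>"
      using on_seg[OF p] False uy dist_triangle[of p y u] dist_commute[of p u] zero_le_dist[of u p]
        zero_le_dist[of p x] \<rho>(2) by linarith+
    then have "{x, y} \<in> block_edges s k \<xi> (cell s p)"
      using e(1) near_2\<rho> by (auto simp: block_edges_def DT_edges_def block_def)
    then show ?thesis
      using e(2) by (auto simp: bad_def)
  qed
  then show ?thesis
    by (simp add: bad_cells_def k_def)
qed

text \<open>The path goes from \<open>x\<close> to the common Voronoi point \<open>u\<close> and on
  to \<open>y\<close>. As \<open>u\<close> is equidistant from both, the second half is the first
  with \<open>x\<close> and \<open>y\<close> exchanged.\<close>

lemma open_edge_cells_connected:
  fixes \<xi> :: "'a::euclidean_space set"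
  assumes s: "0 < s" and xy: "(x, y) \<in> open_rel \<xi> \<eta>"
  shows "cell s x \<in> bad_cells s (real (2 * DIM('a) + 2)) J \<xi> \<eta> \<and>
    (cell s x, cell s y) \<in> (adj (bad_cells s (real (2 * DIM('a) + 2)) J \<xi> \<eta>))\<^sup>*"
proof -
  let ?S = "bad_cells s (real (2 * DIM('a) + 2)) J \<xi> \<eta>"
  have e: "DT_edge \<xi> x y" "\<eta> {x, y}" "DT_edge \<xi> y x" "\<eta> {y, x}"
    using xy by (auto simp: open_rel_def DT_edge_sym insert_commute)
  obtain u where u: "\<And>z. z \<in> \<xi> \<Longrightarrow> dist u x \<le> dist u z" "\<And>z. z \<in> \<xi> \<Longrightarrow> dist u y \<le> dist u z"
    using DT_edge_common_point[OF e(1)] by blast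
  have eq: "dist u y = dist u x"
    using u(1)[of y] u(2)[of x] DT_edgeD[OF e(1)] by simp
  have x: "cell s p \<in> ?S" if "p \<in> closed_segment x u" for p
    by (rule bad_on_segment[where \<eta> = \<eta> and x = x and y = y, OF s _ _ _ eq that])
      (rule e u | assumption)+
  have y: "cell s p \<in> ?S" if "p \<in> closed_segment u y" for p
    by (rule bad_on_segment[where \<eta> = \<eta> and x = y and y = x, OF s _ _ _ eq[symmetric]
          that[unfolded closed_segment_commute[of u y]]])
      (rule e u | assumption)+
  have "(cell s x, cell s u) \<in> (adj ?S)\<^sup>*" "(cell s u, cell s y) \<in> (adj ?S)\<^sup>*"
    using segment_cells_connected[OF s x] segment_cells_connected[OF s y] by auto
  then show ?thesis
    using x[of x] by auto
qed

text \<open>By local finiteness an infinite cluster leaves every block, so its bad cells connect the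
  cell of \<open>x\<close> to one as far away as a chain of length \<open>n\<close>
  requires.\<close>

lemma infinite_cluster_chain:
  fixes \<xi> :: "'a::euclidean_space set"
  assumes s: "0 < s" and m: "0 \<le> m" and \<xi>: "locfin \<xi>" "x \<in> \<xi>"
    and inf: "infinite {y. (x, y) \<in> (open_rel \<xi> \<eta>)\<^sup>*}"
  shows "\<exists>C\<in>far_chains m n (cell s x). \<forall>z\<in>C. bad s (real (2 * DIM('a) + 2)) J \<xi> \<eta> z"
proof -
  let ?S = "bad_cells s (real (2 * DIM('a) + 2)) J \<xi> \<eta>"
  let ?R = "(m + 1) * real n + m"
  have cl: "y \<in> \<xi>" if "(x, y) \<in> (open_rel \<xi> \<eta>)\<^sup>*" for y
    using that \<xi>(2) by (induction rule: rtrancl_induct) (auto simp: open_rel_def DT_edgeD)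
  have "finite (\<xi> \<inter> block s ?R (cell s x))"
    using finite_Int_bounded[OF \<xi>(1) bounded_block[OF s]] .
  then have "\<not> {y. (x, y) \<in> (open_rel \<xi> \<eta>)\<^sup>*} \<subseteq> \<xi> \<inter> block s ?R (cell s x)"
    using inf finite_subset by blast
  moreover have "{y. (x, y) \<in> (open_rel \<xi> \<eta>)\<^sup>*} \<subseteq> \<xi>"
    using cl by blast
  ultimately obtain y where y: "(x, y) \<in> (open_rel \<xi> \<eta>)\<^sup>*" "\<not> near ?R (cell s x) (cell s y)"
    by (auto simp: block_def)
  have "(cell s x, cell s y) \<in> (adj ?S)\<^sup>*"
    using y(1)
  proof (induction rule: rtrancl_induct)
    case (step y z)
    then show ?case
      using open_edge_cells_connected[OF s step.hyps(2)] by (meson rtrancl_trans)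
  qed simp
  \<comment> \<open>The open path to \<open>y\<close> is nontrivial because the cells of
    \<open>x\<close> and \<open>y\<close> are far apart, so \<open>x\<close> has an open
    edge.\<close>
  moreover have "cell s x \<in> ?S"
    using y(1)
  proof (cases rule: converse_rtranclE)
    case base
    have "0 \<le> ?R" using m by simp
    then show ?thesis
      using y(2) base by (auto dest: near_refl)
  next
    case (step y')
    then show ?thesis
      using open_edge_cells_connected[OF s] by blast
  qed
  moreover have "?S \<subseteq> grid"
    by (auto simp: bad_cells_def)
  ultimately obtain C where "C \<in> far_chains m n (cell s x)" "C \<subseteq> ?S"
    using chain_in_connected_set[OF m] y(2) by blast
  then show ?thesis
    by (auto simp: bad_cells_def)
qed

section \<open>Percolation estimates for a fixed point configuration\<close>

lemma disjoint_block_edges: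
  assumes "\<not> near (2 * k) z z'"
  shows "block_edges s k \<xi> z \<inter> block_edges s k \<xi> z' = {}"
proof (rule ccontr)
  assume "block_edges s k \<xi> z \<inter> block_edges s k \<xi> z' \<noteq> {}"
  then obtain x where "x \<in> block s k z" "x \<in> block s k z'"
    by (auto simp: block_edges_def DT_edges_def)
  then have "near (k + k) z z'"
    unfolding block_def mem_Collect_eq by (meson near_trans near_sym)
  then show False
    using assms by simp
qed

text \<open>Every such edge is a subset of the at most \<open>J\<close> points in the block;
  counting all subsets gives \<open>2 ^ J\<close>.\<close>

lemma card_block_edges:
  assumes "0 < s" "locfin \<xi>" "\<not> geobad s k J \<xi> z"
  shows "finite (block_edges s k \<xi> z) \<and> card (block_edges s k \<xi> z) \<le> 2 ^ J"
proof -
  have fin: "finite (\<xi> \<inter> block s k z)"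
    using finite_Int_bounded[OF assms(2) bounded_block[OF assms(1)]] .
  have sub: "block_edges s k \<xi> z \<subseteq> Pow (\<xi> \<inter> block s k z)"
    by (auto simp: block_edges_def DT_edges_def DT_edgeD)
  then have "card (block_edges s k \<xi> z) \<le> 2 ^ card (\<xi> \<inter> block s k z)"
    using card_mono[OF _ sub] fin by (metis card_Pow finite_Pow_iff)
  also have "\<dots> \<le> 2 ^ J"
    using assms(3) by (intro power_increasing) (auto simp: geobad_def)
  finally show ?thesis
    using sub fin finite_subset by blast
qed

text \<open>Bounds the probability, given \<open>\<xi>\<close>, that \<open>z\<close> is bad:
  trivially by 1, or for \<open>q = 2 ^ J * (t * c)\<close> by the union bound over the edges in the
  block.\<close>

definition cell_weight ::
    "real \<Rightarrow> real \<Rightarrow> nat \<Rightarrow> real \<Rightarrow> 'a::euclidean_space \<Rightarrow> 'a set \<Rightarrow> ennreal" where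
  "cell_weight s k J q z \<xi> = (if geobad s k J \<xi> z then 1 else ennreal q)"

text \<open>The cells of \<open>C\<close> which are bad only because of an open edge have disjoint sets of edges in their
  blocks: one open edge per cell gives distinct, hence independent, edges, and \<open>U\<close> is the union over
  the choices of these edges.\<close>

lemma perc_all_bad:
  fixes \<xi> :: "'a::euclidean_space set"
  assumes s: "0 < s" and \<xi>: "locfin \<xi>" and k: "0 \<le> k" and t: "0 \<le> t" and c: "0 \<le> c"
    and w: "\<And>e. e \<in> DT_edges \<xi> \<Longrightarrow> 0 \<le> w e \<and> w e \<le> c"
    and C: "finite C" "pairwise (\<lambda>a b. \<not> near (2 * k + 1) a b) C"
  shows "\<exists>U\<in>sets (perc \<xi> w t). {\<eta> \<in> space (perc \<xi> w t). \<forall>z\<in>C. bad s k J \<xi> \<eta> z} \<subseteq> U \<and>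
    emeasure (perc \<xi> w t) U \<le> (\<Prod>z\<in>C. cell_weight s k J (2 ^ J * (t * c)) z \<xi>)"
proof -
  define B where "B = (\<lambda>e. measure_pmf (bernoulli_pmf (1 - exp (- t * w e))))"
  interpret product_prob_space B "DT_edges \<xi>"
    unfolding B_def by unfold_locales
  have \<mu>: "perc \<xi> w t = Pi\<^sub>M (DT_edges \<xi>) B"
    unfolding perc_def B_def ..
  define C0 where "C0 = {z \<in> C. \<not> geobad s k J \<xi> z}"
  define E where "E = block_edges s k \<xi>"
  define V where "V \<phi> = {\<eta> \<in> space (perc \<xi> w t). \<forall>e\<in>\<phi> ` C0. \<eta> e \<in> {True}}"
    for \<phi> :: "'a \<Rightarrow> 'a set"
  define U where "U = (\<Union>\<phi>\<in>PiE C0 E. V \<phi>)"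
  have C0: "finite C0" "C0 \<subseteq> C"
    using C by (auto simp: C0_def)
  have E: "finite (E z)" "card (E z) \<le> 2 ^ J" if "z \<in> C0" for z
    using card_block_edges[OF s \<xi>, of k J z] that by (auto simp: C0_def E_def)
  have fin: "finite (PiE C0 E)"
    using C0(1) E(1) by (rule finite_PiE)
  have sub: "\<phi> ` C0 \<subseteq> DT_edges \<xi>" if "\<phi> \<in> PiE C0 E" for \<phi>
    using that by (auto simp: E_def block_edges_def PiE_def Pi_def)
  have inj: "inj_on \<phi> C0" if \<phi>: "\<phi> \<in> PiE C0 E" for \<phi>
  proof (rule inj_onI, rule ccontr)
    fix a b assume ab: "a \<in> C0" "b \<in> C0" "\<phi> a = \<phi> b" "a \<noteq> b"
    then have "\<not> near (2 * k + 1) a b"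
      using C(2) C0(2) by (auto simp: pairwise_def)
    then have "\<not> near (2 * k) a b"
      using near_mono[of "2 * k" a b "2 * k + 1"] by auto
    then have "E a \<inter> E b = {}"
      unfolding E_def by (rule disjoint_block_edges)
    then show False
      using \<phi> ab by (metis PiE_mem disjoint_iff)
  qed
  have V_sets: "V \<phi> \<in> sets (perc \<xi> w t)" if "\<phi> \<in> PiE C0 E" for \<phi>
  proof -
    have "{\<eta> \<in> space (perc \<xi> w t). \<eta> e \<in> {True}} \<in> sets (perc \<xi> w t)" if "e \<in> \<phi> ` C0" for e
    proof -
      have "e \<in> DT_edges \<xi>"
        using sub[OF \<open>\<phi> \<in> PiE C0 E\<close>] that by blast
      then have "(\<lambda>\<eta>. \<eta> e) -` {True} \<inter> space (Pi\<^sub>M (DT_edges \<xi>) B) \<in> sets (Pi\<^sub>M (DT_edges \<xi>) B)"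
        by (intro measurable_sets[OF measurable_component_singleton]) (auto simp: B_def)
      then show ?thesis
        by (simp add: \<mu> vimage_def Int_def conj_commute)
    qed
    then show ?thesis
      unfolding V_def using C0(1) by (intro sets.sets_Collect_finite_All) auto
  qed
  have edge: "emeasure (B e) {True} \<le> ennreal (t * c)" if "e \<in> DT_edges \<xi>" for e
  proof -
    have nn: "0 \<le> t * w e"
      using w[OF that] t by simp
    have "1 - exp (- (t * w e)) \<le> t * w e"
      using exp_ge_add_one_self[of "- (t * w e)"] by simp
    also have "\<dots> \<le> t * c"
      using w[OF that] t by (simp add: mult_left_mono)
    finally have "1 - exp (- (t * w e)) \<le> t * c" .
    then show ?thesis
      using nn by (simp add: B_def emeasure_pmf_single ennreal_leI)
  qed
  have V: "emeasure (perc \<xi> w t) (V \<phi>) \<le> ennreal (t * c) ^ card C0" if \<phi>: "\<phi> \<in> PiE C0 E" for \<phi>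
  proof -
    \<comment> \<open>A cylinder event of the product measure; injectivity of \<open>\<phi>\<close>
      ensures that it has one factor for each cell of \<open>C0\<close>.\<close>
    have "emeasure (perc \<xi> w t) (V \<phi>) = (\<Prod>e\<in>\<phi> ` C0. emeasure (B e) {True})"
      unfolding V_def \<mu> using sub[OF \<phi>] C0(1)
      by (intro emeasure_PiM_Collect) (auto simp: B_def)
    also have "\<dots> \<le> (\<Prod>e\<in>\<phi> ` C0. ennreal (t * c))"
      using sub[OF \<phi>] by (intro prod_mono_ennreal edge) auto
    also have "\<dots> = ennreal (t * c) ^ card C0"
      using inj[OF \<phi>] by (simp add: card_image)
    finally show ?thesis .
  qed
  have "emeasure (perc \<xi> w t) U \<le> (\<Sum>\<phi>\<in>PiE C0 E. emeasure (perc \<xi> w t) (V \<phi>))"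
    unfolding U_def using V_sets fin by (intro emeasure_subadditive_finite) auto
  also have "\<dots> \<le> (\<Sum>\<phi>\<in>PiE C0 E. ennreal (t * c) ^ card C0)"
    by (intro sum_mono V)
  also have "\<dots> = of_nat (card (PiE C0 E)) * ennreal (t * c) ^ card C0"
    by simp
  also have "\<dots> \<le> of_nat ((2 ^ J) ^ card C0) * ennreal (t * c) ^ card C0"
  proof -
    have "card (PiE C0 E) = (\<Prod>z\<in>C0. card (E z))"
      using C0(1) by (rule card_PiE)
    also have "\<dots> \<le> (\<Prod>z\<in>C0. 2 ^ J)"
      using E(2) by (intro prod_mono) auto
    finally show ?thesis
      by (intro mult_right_mono) (auto simp del: of_nat_power)
  qed
  also have "\<dots> = ennreal (2 ^ J * (t * c)) ^ card C0"
    using t c by (simp add: power_mult_distrib ennreal_mult ennreal_power[symmetric]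
        flip: ennreal_numeral)
  also have "\<dots> = (\<Prod>z\<in>C. cell_weight s k J (2 ^ J * (t * c)) z \<xi>)"
  proof -
    \<comment> \<open>Geometrically bad cells have weight 1, so only \<open>C0\<close>
      contributes.\<close>
    have "(\<Prod>z\<in>C. cell_weight s k J (2 ^ J * (t * c)) z \<xi>)
        = (\<Prod>z\<in>C0. cell_weight s k J (2 ^ J * (t * c)) z \<xi>)"
      using C(1) C0(2) by (intro prod.mono_neutral_right) (auto simp: C0_def cell_weight_def)
    also have "\<dots> = (\<Prod>z\<in>C0. ennreal (2 ^ J * (t * c)))"
      by (rule prod.cong) (auto simp: C0_def cell_weight_def)
    finally show ?thesis
      by simp
  qed
  finally have "emeasure (perc \<xi> w t) U \<le> (\<Prod>z\<in>C. cell_weight s k J (2 ^ J * (t * c)) z \<xi>)" .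
  moreover have "U \<in> sets (perc \<xi> w t)"
    unfolding U_def using fin V_sets by blast
  moreover have "{\<eta> \<in> space (perc \<xi> w t). \<forall>z\<in>C. bad s k J \<xi> \<eta> z} \<subseteq> U"
  proof
    fix \<eta> assume \<eta>: "\<eta> \<in> {\<eta> \<in> space (perc \<xi> w t). \<forall>z\<in>C. bad s k J \<xi> \<eta> z}"
    then have "\<forall>z\<in>C0. \<exists>e. e \<in> E z \<and> \<eta> e"
      by (auto simp: C0_def E_def bad_def)
    then obtain \<phi> where "\<forall>z\<in>C0. \<phi> z \<in> E z \<and> \<eta> (\<phi> z)"
      by (metis bchoice)
    then have "restrict \<phi> C0 \<in> PiE C0 E" "\<eta> \<in> V (restrict \<phi> C0)"
      using \<eta> by (auto simp: V_def)
    then show "\<eta> \<in> U"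
      unfolding U_def by blast
  qed
  ultimately show ?thesis
    by blast
qed

section \<open>Stationary point processes with finite range of dependence\<close>

lemma space_NN [simp]: "space NN = Nsp"
  unfolding NN_def by (rule space_measure_of) auto

lemma sets_NN_npts: "A \<in> sets borel \<Longrightarrow> {\<xi> \<in> Nsp. npts \<xi> A = n} \<in> sets NN"
  unfolding NN_def by (subst sets_measure_of) auto

lemma npts_eq_of_nat_iff: "npts \<xi> A = of_nat j \<longleftrightarrow> finite (\<xi> \<inter> A) \<and> card (\<xi> \<inter> A) = j"
  by (simp add: npts_def emeasure_count_space)

lemma sets_NN_void:
  assumes "A \<in> sets borel"
  shows "{\<xi> \<in> Nsp. \<xi> \<inter> A = {}} \<in> sets NN"
proof -
  have "{\<xi> \<in> Nsp. \<xi> \<inter> A = {}} = {\<xi> \<in> Nsp. npts \<xi> A = of_nat 0}"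
    unfolding npts_eq_of_nat_iff by auto
  then show ?thesis
    using sets_NN_npts[OF assms] by simp
qed

text \<open>Boundedness makes the trace on \<open>A\<close> finite, so \<open>card\<close> agrees
  with \<open>npts\<close> and the complement is a finite union of generators.\<close>

lemma sets_NN_card_gt:
  assumes "A \<in> sets borel" "bounded A"
  shows "{\<xi> \<in> Nsp. J < card (\<xi> \<inter> A)} \<in> sets NN"
proof -
  have "{\<xi> \<in> Nsp. J < card (\<xi> \<inter> A)} = Nsp - (\<Union>j\<in>{..J}. {\<xi> \<in> Nsp. npts \<xi> A = of_nat j})"
    unfolding npts_eq_of_nat_iff using finite_Int_bounded[OF _ assms(2)] by (auto simp: Nsp_def)
  then show ?thesis
    using sets_NN_npts[OF assms(1)] sets.top[of NN] by auto
qed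

lemma sets_NN_geobad:
  assumes "0 < s"
  shows "{\<xi> \<in> Nsp. geobad s k J \<xi> z} \<in> sets NN"
proof -
  have "{\<xi> \<in> Nsp. geobad s k J \<xi> z} =
      (\<Union>z'\<in>{z' \<in> grid. near k z z'}. {\<xi> \<in> Nsp. \<xi> \<inter> block s 0 z' = {}}) \<union>
      {\<xi> \<in> Nsp. J < card (\<xi> \<inter> block s k z)}"
    by (auto simp: geobad_def)
  also have "\<dots> \<in> sets NN"
    by (intro sets.Un sets.finite_UN finite_grid_near sets_NN_void sets_NN_card_gt
        block_measurable bounded_block[OF assms])
  finally show ?thesis .
qed

lemma measurable_cell_weight:
  assumes "0 < s"
  shows "cell_weight s k J q z \<in> borel_measurable NN"
  unfolding cell_weight_def[abs_def]
  using sets_NN_geobad[OF assms] by (intro measurable_If) auto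

text \<open>All inspected cells lie in the block of \<open>z\<close>; this locality is what turns
  finite range of dependence into independence of weights.\<close>

lemma cell_weight_Int:
  assumes "block s k z \<subseteq> B"
  shows "cell_weight s k J q z (\<xi> \<inter> B) = cell_weight s k J q z \<xi>"
proof -
  have "\<xi> \<inter> B \<inter> block s k z = \<xi> \<inter> block s k z"
    using assms by blast
  moreover have "\<xi> \<inter> B \<inter> block s 0 z' = \<xi> \<inter> block s 0 z'" if "near k z z'" for z'
    using assms block_subset_block[OF that] by blast
  ultimately show ?thesis
    by (auto simp: cell_weight_def geobad_def)
qed

lemma locfin_Int: "locfin \<xi> \<Longrightarrow> locfin (\<xi> \<inter> A)"
  unfolding locfin_def by (metis Int_assoc Int_commute finite_Int)

lemma shift_Int: "shift v \<xi> \<inter> A = (\<lambda>y. y - v) ` (\<xi> \<inter> {x. x - v \<in> A})"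
  by (auto simp: shift_def)

lemma locfin_shift:
  assumes "locfin \<xi>"
  shows "locfin (shift v \<xi>)"
  unfolding locfin_def
proof (intro allI impI)
  fix K :: "'a set" assume "compact K"
  have "{x. x - v \<in> K} = (+) v ` K"
    by (auto intro: image_eqI[of _ _ "_ - v"])
  then have "finite (\<xi> \<inter> {x. x - v \<in> K})"
    using assms \<open>compact K\<close> compact_translation[of K v] by (simp add: locfin_def)
  then show "finite (shift v \<xi> \<inter> K)"
    by (simp add: shift_Int)
qed

lemma shift_shift: "shift (- v) (shift v \<xi>) = \<xi>"
  by (auto simp: shift_def image_image)

section \<open>Translation invariance and monotone limits\<close>

locale stationary_point_process = prob_space P
  for P :: "'a::euclidean_space set measure" +
  assumes sets_P: "sets P = sets NN" and stationary: "stationary P"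
begin

lemma space_P [simp]: "space P = Nsp"
  using sets_eq_imp_space_eq[OF sets_P] by simp

text \<open>Stationarity speaks of images; the image under \<open>shift (- v)\<close> is the
  preimage under \<open>shift v\<close>, its inverse on \<open>Nsp\<close>.\<close>

lemma prob_shift:
  assumes "{\<xi> \<in> Nsp. \<Phi> \<xi>} \<in> sets NN"
  shows "prob {\<xi> \<in> Nsp. \<Phi> (shift v \<xi>)} = prob {\<xi> \<in> Nsp. \<Phi> \<xi>}"
proof -
  have "shift (- v) ` {\<xi> \<in> Nsp. \<Phi> \<xi>} = {\<xi> \<in> Nsp. \<Phi> (shift v \<xi>)}"
  proof (intro equalityI subsetI)
    fix \<xi> assume "\<xi> \<in> {\<xi> \<in> Nsp. \<Phi> (shift v \<xi>)}"
    then have "shift v \<xi> \<in> {\<xi> \<in> Nsp. \<Phi> \<xi>}"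
      by (simp add: Nsp_def locfin_shift)
    then show "\<xi> \<in> shift (- v) ` {\<xi> \<in> Nsp. \<Phi> \<xi>}"
      by (metis shift_shift image_eqI)
  next
    fix \<xi> assume "\<xi> \<in> shift (- v) ` {\<xi> \<in> Nsp. \<Phi> \<xi>}"
    then obtain \<zeta> where "\<zeta> \<in> Nsp" "\<Phi> \<zeta>" "\<xi> = shift (- v) \<zeta>"
      by blast
    then show "\<xi> \<in> {\<xi> \<in> Nsp. \<Phi> (shift v \<xi>)}"
      using shift_shift[of "- v" \<zeta>] by (simp add: Nsp_def locfin_shift)
  qed
  moreover have "emeasure P (shift (- v) ` {\<xi> \<in> Nsp. \<Phi> \<xi>}) = emeasure P {\<xi> \<in> Nsp. \<Phi> \<xi>}"
    using stationary assms by (simp add: stationary_def)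
  ultimately show ?thesis
    by (simp add: measure_def)
qed

lemma prob_void_translate:
  assumes "A \<in> sets borel"
  shows "prob {\<xi> \<in> Nsp. \<xi> \<inter> {x. x - v \<in> A} = {}} = prob {\<xi> \<in> Nsp. \<xi> \<inter> A = {}}"
  using prob_shift[OF sets_NN_void[OF assms], of v] by (simp add: shift_Int)

lemma prob_card_gt_translate:
  assumes "A \<in> sets borel" "bounded A"
  shows "prob {\<xi> \<in> Nsp. J < card (\<xi> \<inter> {x. x - v \<in> A})} = prob {\<xi> \<in> Nsp. J < card (\<xi> \<inter> A)}"
  using prob_shift[OF sets_NN_card_gt[OF assms], of J v] by (simp add: shift_Int card_image)

lemma prob_void_cball_tendsto:
  "(\<lambda>j. prob {\<xi> \<in> Nsp. \<xi> \<inter> cball 0 (real j) = {}}) \<longlonglongrightarrow> prob {\<xi> \<in> Nsp. \<xi> \<inter> UNIV = {}}"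
proof -
  define V where "V j = {\<xi> \<in> Nsp. \<xi> \<inter> cball (0 :: 'a) (real j) = {}}" for j
  have "decseq V"
    unfolding decseq_def V_def by (auto 4 3 simp: disjoint_iff intro: order_trans)
  moreover have "range V \<subseteq> sets P"
    by (auto simp: V_def sets_P intro: sets_NN_void)
  ultimately have "(\<lambda>j. prob (V j)) \<longlonglongrightarrow> prob (\<Inter>j. V j)"
    by (intro finite_Lim_measure_decseq)
  moreover have "(\<Inter>j. V j) = {\<xi> \<in> Nsp. \<xi> \<inter> UNIV = {}}"
    unfolding V_def using real_arch_simple by (fastforce simp: disjoint_iff)
  ultimately show ?thesis
    by (simp add: V_def)
qed

lemma prob_card_gt_tendsto_0:
  fixes A :: "'a set"
  assumes "A \<in> sets borel" "bounded A"
  shows "(\<lambda>J. prob {\<xi> \<in> Nsp. J < card (\<xi> \<inter> A)}) \<longlonglongrightarrow> 0"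
proof -
  define V where "V J = {\<xi> \<in> Nsp. J < card (\<xi> \<inter> A)}" for J
  have "decseq V"
    unfolding decseq_def V_def by auto
  moreover have "range V \<subseteq> sets P"
    using assms by (auto simp: V_def sets_P intro: sets_NN_card_gt)
  ultimately have "(\<lambda>j. prob (V j)) \<longlonglongrightarrow> prob (\<Inter>j. V j)"
    by (intro finite_Lim_measure_decseq)
  moreover have "(\<Inter>j. V j) = {}"
    by (auto simp: V_def)
  ultimately show ?thesis
    by (simp add: V_def)
qed

end

section \<open>Consequences of finite range of dependence\<close>

locale finite_range_point_process = stationary_point_process +
  fixes L :: real
  assumes L_pos: "0 < L"
    and indep: "\<And>A B. A \<in> sets borel \<Longrightarrow> B \<in> sets borel \<Longrightarrow> (\<And>a b. a \<in> A \<Longrightarrow> b \<in> B \<Longrightarrow> L \<le> dist a b) \<Longrightarrow>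
      indep_var NN (\<lambda>\<xi>. \<xi> \<inter> A) NN (\<lambda>\<xi>. \<xi> \<inter> B)"
begin

text \<open>Two far apart translates of a large ball are simultaneously void with probability at least
  \<open>p = P(\<xi> = {})\<close>, so \<open>p \<le> p\<^sup>2\<close> in the limit.\<close>

lemma prob_empty_zero_one: "prob {\<xi> \<in> Nsp. \<xi> \<inter> UNIV = {}} = 0 \<or> prob {\<xi> \<in> Nsp. \<xi> \<inter> UNIV = {}} = 1"
proof -
  define p where "p = prob {\<xi> \<in> Nsp. \<xi> \<inter> (UNIV :: 'a set) = {}}"
  define V where "V j = prob {\<xi> \<in> Nsp. \<xi> \<inter> cball (0 :: 'a) (real j) = {}}" for j
  have "p \<le> V j * V j" for j
  proof -
    obtain b :: 'a where b: "b \<in> Basis"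
      using nonempty_Basis by blast
    \<comment> \<open>Centres at distance \<open>2 * j + L\<close> keep two balls of radius
      \<open>j\<close> at distance at least \<open>L\<close>.\<close>
    define v where "v = (2 * real j + L) *\<^sub>R b"
    let ?A = "cball (0 :: 'a) (real j)" and ?B = "{x. x - v \<in> cball 0 (real j)}"
    let ?E = "{\<xi> \<in> Nsp. \<xi> \<inter> (UNIV :: 'a set) = {}}"
    have B: "?B = cball v (real j)"
      by (auto simp: dist_norm norm_minus_commute)
    have "L \<le> dist a c" if "a \<in> ?A" "c \<in> ?B" for a c
    proof -
      have "2 * real j + L = dist 0 v"
        using L_pos b by (simp add: v_def)
      also have "\<dots> \<le> dist 0 a + dist a c + dist c v"
        by (meson add_mono_thms_linordered_semiring(3) dist_triangle order_trans)
      finally have "2 * real j + L \<le> dist 0 a + dist a c + dist c v" .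
      moreover have "dist 0 a \<le> real j" "dist c v \<le> real j"
        using that by (simp_all add: dist_norm norm_minus_commute)
      ultimately show ?thesis
        by linarith
    qed
    then have "indep_var NN (\<lambda>\<xi>. \<xi> \<inter> ?A) NN (\<lambda>\<xi>. \<xi> \<inter> ?B)"
      by (intro indep) (auto simp: B)
    \<comment> \<open>A trace is void iff it lies in the event of the empty configuration, written
      as the void event of \<open>UNIV\<close>.\<close>
    from indep_varD[OF this sets_NN_void[of UNIV] sets_NN_void[of UNIV]]
    have "prob ((\<lambda>\<xi>. (\<xi> \<inter> ?A, \<xi> \<inter> ?B)) -` (?E \<times> ?E) \<inter> space P)
        = prob ((\<lambda>\<xi>. \<xi> \<inter> ?A) -` ?E \<inter> space P) * prob ((\<lambda>\<xi>. \<xi> \<inter> ?B) -` ?E \<inter> space P)"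
      by simp
    moreover have [simp]: "locfin ({} :: 'a set)"
      by (simp add: locfin_def)
    moreover have "(\<lambda>\<xi>. (\<xi> \<inter> A, \<xi> \<inter> B)) -` (?E \<times> ?E) \<inter> space P = {\<xi> \<in> Nsp. \<xi> \<inter> (A \<union> B) = {}}"
      "(\<lambda>\<xi>. \<xi> \<inter> A) -` ?E \<inter> space P = {\<xi> \<in> Nsp. \<xi> \<inter> A = {}}" for A B
      by (auto simp: Nsp_def locfin_Int Int_Un_distrib)
    moreover have "prob {\<xi> \<in> Nsp. \<xi> \<inter> ?B = {}} = V j"
      unfolding V_def by (rule prob_void_translate) simp
    ultimately have "prob {\<xi> \<in> Nsp. \<xi> \<inter> (?A \<union> ?B) = {}} = V j * V j"
      by (simp add: V_def)
    moreover have "p \<le> prob {\<xi> \<in> Nsp. \<xi> \<inter> (?A \<union> ?B) = {}}"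
      unfolding p_def by (intro finite_measure_mono) (auto simp: sets_P B intro!: sets_NN_void)
    ultimately show ?thesis
      by simp
  qed
  moreover have "(\<lambda>j. V j * V j) \<longlonglongrightarrow> p * p"
    unfolding V_def p_def by (intro tendsto_mult prob_void_cball_tendsto)
  ultimately have "p \<le> p * p"
    by (intro LIMSEQ_le_const) auto
  moreover have "0 \<le> p" "p \<le> 1"
    by (auto simp: p_def)
  ultimately have "p = 0 \<or> p = 1"
    by (metis antisym mult_le_cancel_left1 order_le_less)
  then show ?thesis
    by (simp add: p_def)
qed

text \<open>Union bound over the empty cells, the crowded block and the edge weight; stationarity
  makes it uniform in \<open>z\<close>.\<close>

lemma nn_integral_cell_weight_le:
  assumes "0 < s" "0 \<le> q" "z \<in> grid"
  shows "(\<integral>\<^sup>+\<xi>. cell_weight s k J q z \<xi> \<partial>P) \<le> ennreal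
    (real (card {z' \<in> grid. near k (0 :: 'a) z'}) * prob {\<xi> \<in> Nsp. \<xi> \<inter> block s 0 0 = {}}
      + prob {\<xi> \<in> Nsp. J < card (\<xi> \<inter> block s k 0)} + q)"
proof -
  let ?N = "{z' \<in> grid. near k z z'}"
  let ?G = "{\<xi> \<in> Nsp. geobad s k J \<xi> z}"
  let ?D = "{\<xi> \<in> Nsp. J < card (\<xi> \<inter> block s k z)}"
  have D: "?D \<in> events"
    unfolding sets_P by (intro sets_NN_card_gt block_measurable bounded_block assms)
  have V: "{\<xi> \<in> Nsp. \<xi> \<inter> block s 0 z' = {}} \<in> events" for z'
    unfolding sets_P by (intro sets_NN_void block_measurable)
  have V_eq: "prob {\<xi> \<in> Nsp. \<xi> \<inter> block s 0 z' = {}} = prob {\<xi> \<in> Nsp. \<xi> \<inter> block s 0 0 = {}}"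
    if "z' \<in> grid" for z'
    using prob_void_translate[OF block_measurable, of "s *\<^sub>R z'" s 0 0]
    by (simp add: block_translate[OF assms(1) that])
  have Vu: "(\<Union>z'\<in>?N. {\<xi> \<in> Nsp. \<xi> \<inter> block s 0 z' = {}}) \<in> events"
    using V by (intro sets.finite_UN finite_grid_near) auto
  have "?G = (\<Union>z'\<in>?N. {\<xi> \<in> Nsp. \<xi> \<inter> block s 0 z' = {}}) \<union> ?D"
    by (auto simp: geobad_def)
  then have "prob ?G \<le> prob (\<Union>z'\<in>?N. {\<xi> \<in> Nsp. \<xi> \<inter> block s 0 z' = {}}) + prob ?D"
    using measure_Un_le[OF Vu D] by simp
  also have "prob (\<Union>z'\<in>?N. {\<xi> \<in> Nsp. \<xi> \<inter> block s 0 z' = {}})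
      \<le> (\<Sum>z'\<in>?N. prob {\<xi> \<in> Nsp. \<xi> \<inter> block s 0 z' = {}})"
    using V by (intro finite_measure_subadditive_finite finite_grid_near) auto
  also have "\<dots> = (\<Sum>z'\<in>?N. prob {\<xi> \<in> Nsp. \<xi> \<inter> block s 0 0 = {}})"
    using V_eq by (intro sum.cong) auto
  also have "\<dots> = real (card {z' \<in> grid. near k (0 :: 'a) z'}) * prob {\<xi> \<in> Nsp. \<xi> \<inter> block s 0 0 = {}}"
    by (simp add: card_grid_near[OF assms(3)])
  also have "prob ?D = prob {\<xi> \<in> Nsp. J < card (\<xi> \<inter> block s k 0)}"
    using prob_card_gt_translate[OF block_measurable bounded_block[OF assms(1), of k 0], of J "s *\<^sub>R z"]
    by (simp add: block_translate[OF assms(1,3)])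
  finally have G: "prob ?G \<le> real (card {z' \<in> grid. near k (0 :: 'a) z'}) *
      prob {\<xi> \<in> Nsp. \<xi> \<inter> block s 0 0 = {}} + prob {\<xi> \<in> Nsp. J < card (\<xi> \<inter> block s k 0)}"
    by simp
  have "?G \<in> events"
    unfolding sets_P by (rule sets_NN_geobad[OF assms(1)])
  moreover have "(\<integral>\<^sup>+\<xi>. cell_weight s k J q z \<xi> \<partial>P) \<le> (\<integral>\<^sup>+\<xi>. indicator ?G \<xi> + ennreal q \<partial>P)"
    by (intro nn_integral_mono) (auto simp: cell_weight_def)
  ultimately have "(\<integral>\<^sup>+\<xi>. cell_weight s k J q z \<xi> \<partial>P) \<le> emeasure P ?G + ennreal q"
    using prob_space by (simp add: nn_integral_add emeasure_space_1[simplified])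
  also have "\<dots> = ennreal (prob ?G + q)"
    using assms(2) by (simp add: emeasure_eq_measure)
  also have "\<dots> \<le> ennreal
    (real (card {z' \<in> grid. near k (0 :: 'a) z'}) * prob {\<xi> \<in> Nsp. \<xi> \<inter> block s 0 0 = {}}
      + prob {\<xi> \<in> Nsp. J < card (\<xi> \<inter> block s k 0)} + q)"
    using G by (intro ennreal_leI) simp
  finally show ?thesis .
qed

text \<open>Each of the three terms gets \<open>r / 3\<close>: a large \<open>s\<close> makes voids
  rare, then a large \<open>J\<close> makes crowding rare in blocks of that size, and
  \<open>q\<close> is \<open>r / 3\<close> itself.\<close>

lemma exists_small_cell_weight:
  assumes "prob {\<xi> \<in> Nsp. \<xi> \<inter> UNIV = {}} = 0" "0 < r"
  shows "\<exists>s J q. L \<le> s \<and> 0 < q \<and> (\<forall>z\<in>grid. (\<integral>\<^sup>+\<xi>. cell_weight s k J q z \<xi> \<partial>P) \<le> ennreal r)"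
proof -
  define N where "N = real (card {z' \<in> grid. near k (0 :: 'a) z'})"
  have "(\<lambda>j. N * prob {\<xi> \<in> Nsp. \<xi> \<inter> cball (0 :: 'a) (real j) = {}}) \<longlonglongrightarrow> N * 0"
    using prob_void_cball_tendsto unfolding assms(1) by (intro tendsto_mult tendsto_const)
  then have "\<forall>\<^sub>F j in sequentially. N * prob {\<xi> \<in> Nsp. \<xi> \<inter> cball (0 :: 'a) (real j) = {}} < r / 3"
    using assms(2) by (intro order_tendstoD) auto
  then obtain j where j: "N * prob {\<xi> \<in> Nsp. \<xi> \<inter> cball (0 :: 'a) (real j) = {}} < r / 3"
    using eventually_happens'[OF sequentially_bot] by blast
  \<comment> \<open>A cell of this side contains a ball of radius \<open>j\<close> around its
    centre, with room to spare for the half-open faces, and \<open>s \<ge> L\<close> gives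
    independence of far blocks.\<close>
  define s where "s = L + 2 * real j"
  have s: "0 < s" "L \<le> s"
    using L_pos by (auto simp: s_def)
  have "(\<lambda>J. prob {\<xi> \<in> Nsp. J < card (\<xi> \<inter> block s k (0 :: 'a))}) \<longlonglongrightarrow> 0"
    by (intro prob_card_gt_tendsto_0 block_measurable bounded_block s)
  then have "\<forall>\<^sub>F J in sequentially. prob {\<xi> \<in> Nsp. J < card (\<xi> \<inter> block s k (0 :: 'a))} < r / 3"
    using assms(2) by (intro order_tendstoD) auto
  then obtain J where J: "prob {\<xi> \<in> Nsp. J < card (\<xi> \<inter> block s k (0 :: 'a))} < r / 3"
    using eventually_happens'[OF sequentially_bot] by blast
  have sub: "{x. x - (s / 2) *\<^sub>R One \<in> cball 0 (real j)} \<subseteq> block s 0 (0 :: 'a)"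
  proof
    fix x :: 'a assume x: "x \<in> {x. x - (s / 2) *\<^sub>R One \<in> cball 0 (real j)}"
    have "\<lfloor>(x \<bullet> b) / s\<rfloor> = 0" if b: "b \<in> Basis" for b
    proof -
      have "\<bar>(x - (s / 2) *\<^sub>R One) \<bullet> b\<bar> \<le> real j"
        using Basis_le_norm[OF b, of "x - (s / 2) *\<^sub>R One"] x by simp
      then have "\<bar>x \<bullet> b - s / 2\<bar> \<le> real j"
        using b by (simp add: inner_diff_left)
      then have "0 \<le> x \<bullet> b" "x \<bullet> b < s"
        using L_pos by (auto simp: s_def abs_le_iff field_simps)
      then show ?thesis
        using s(1) by (simp add: floor_eq_iff)
    qed
    then show "x \<in> block s 0 0"
      by (simp add: block_def near_def)
  qed
  have "prob {\<xi> \<in> Nsp. \<xi> \<inter> block s 0 (0 :: 'a) = {}}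
      \<le> prob {\<xi> \<in> Nsp. \<xi> \<inter> {x. x - (s / 2) *\<^sub>R One \<in> cball (0 :: 'a) (real j)} = {}}"
  proof (rule finite_measure_mono)
    have "{x. x - (s / 2) *\<^sub>R One \<in> cball 0 (real j)} = cball ((s / 2) *\<^sub>R One :: 'a) (real j)"
      by (auto simp: dist_norm norm_minus_commute)
    then show "{\<xi> \<in> Nsp. \<xi> \<inter> {x. x - (s / 2) *\<^sub>R One \<in> cball (0 :: 'a) (real j)} = {}} \<in> events"
      unfolding sets_P by (intro sets_NN_void) simp
  qed (use sub in blast)
  also have "\<dots> = prob {\<xi> \<in> Nsp. \<xi> \<inter> cball (0 :: 'a) (real j) = {}}"
    by (intro prob_void_translate) simp
  finally have "N * prob {\<xi> \<in> Nsp. \<xi> \<inter> block s 0 (0 :: 'a) = {}} \<le> r / 3"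
    using j by (smt (verit) N_def mult_left_mono of_nat_0_le_iff)
  then have bound: "N * prob {\<xi> \<in> Nsp. \<xi> \<inter> block s 0 (0 :: 'a) = {}}
      + prob {\<xi> \<in> Nsp. J < card (\<xi> \<inter> block s k (0 :: 'a))} + r / 3 \<le> r"
    using J by linarith
  have "(\<integral>\<^sup>+\<xi>. cell_weight s k J (r / 3) z \<xi> \<partial>P) \<le> ennreal r" if "z \<in> grid" for z
    using nn_integral_cell_weight_le[OF s(1) _ that, of "r / 3" k J] assms(2)
      ennreal_leI[OF bound] unfolding N_def by (meson divide_nonneg_pos less_imp_le order_trans zero_less_numeral)
  then show ?thesis
    using s(2) assms(2) by (intro exI[of _ s] exI[of _ J] exI[of _ "r / 3"]) auto
qed

text \<open>Splits off one cell at a time: its block is at distance at least \<open>L\<close> from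
  the union of the other blocks, so its weight is independent of their product.\<close>

lemma nn_integral_prod_cell_weight:
  assumes s: "L \<le> s" and k: "0 \<le> k"
    and C: "finite C" "pairwise (\<lambda>a b. \<not> near (2 * k + 1) a b) C"
    and r: "\<And>z. z \<in> C \<Longrightarrow> (\<integral>\<^sup>+\<xi>. cell_weight s k J q z \<xi> \<partial>P) \<le> r"
  shows "(\<integral>\<^sup>+\<xi>. (\<Prod>z\<in>C. cell_weight s k J q z \<xi>) \<partial>P) \<le> r ^ card C"
  using C r
proof (induction C rule: finite_induct)
  case empty
  then show ?case
    using emeasure_space_1 by simp
next
  case (insert z C)
  have s0: "0 < s"
    using s L_pos by simp
  let ?B = "\<Union>c\<in>C. block s k c"
  have far: "\<not> near (2 * k + 1) z c" if "c \<in> C" for c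
    using insert.prems(1) insert.hyps(2) that by (auto simp: pairwise_insert)
  have "indep_var NN (\<lambda>\<xi>. \<xi> \<inter> block s k z) NN (\<lambda>\<xi>. \<xi> \<inter> ?B)"
  proof (rule indep)
    show "?B \<in> sets borel"
      using insert.hyps(1) by (intro sets.finite_UN block_measurable)
    show "L \<le> dist a b" if "a \<in> block s k z" "b \<in> ?B" for a b
      using that far_blocks[OF s0 far] s by fastforce
  qed simp
  moreover have "(\<lambda>\<xi>. \<Prod>c\<in>C. cell_weight s k J q c \<xi>) \<in> borel_measurable NN"
    by (intro borel_measurable_prod_ennreal measurable_cell_weight s0)
  ultimately have "indep_var borel (cell_weight s k J q z \<circ> (\<lambda>\<xi>. \<xi> \<inter> block s k z))
      borel ((\<lambda>\<xi>. \<Prod>c\<in>C. cell_weight s k J q c \<xi>) \<circ> (\<lambda>\<xi>. \<xi> \<inter> ?B))"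
    by (intro indep_var_compose[OF _ measurable_cell_weight[OF s0]])
  moreover have "cell_weight s k J q z \<circ> (\<lambda>\<xi>. \<xi> \<inter> block s k z) = cell_weight s k J q z"
    by (auto simp: cell_weight_Int)
  moreover have "(\<lambda>\<xi>. \<Prod>c\<in>C. cell_weight s k J q c \<xi>) \<circ> (\<lambda>\<xi>. \<xi> \<inter> ?B)
      = (\<lambda>\<xi>. \<Prod>c\<in>C. cell_weight s k J q c \<xi>)"
    by (rule ext, simp only: comp_apply, intro prod.cong refl cell_weight_Int) blast
  ultimately have iv0: "indep_var borel (cell_weight s k J q z)
      borel (\<lambda>\<xi>. \<Prod>c\<in>C. cell_weight s k J q c \<xi>)"
    by simp
  \<comment> \<open>Independence of a pair is encoded by families over \<open>bool\<close>; the
    product formula expects the constant family of spaces.\<close>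
  have cb: "case_bool borel borel = (\<lambda>_ :: bool. borel :: ennreal measure)"
    by (rule ext) (simp split: bool.split)
  have iv: "indep_vars (\<lambda>_. borel)
      (case_bool (cell_weight s k J q z) (\<lambda>\<xi>. \<Prod>c\<in>C. cell_weight s k J q c \<xi>)) UNIV"
    using iv0 unfolding indep_var_def cb .
  have "(\<integral>\<^sup>+\<xi>. (\<Prod>c\<in>insert z C. cell_weight s k J q c \<xi>) \<partial>P)
      = (\<integral>\<^sup>+\<xi>. cell_weight s k J q z \<xi> \<partial>P) * (\<integral>\<^sup>+\<xi>. (\<Prod>c\<in>C. cell_weight s k J q c \<xi>) \<partial>P)"
    using indep_vars_nn_integral[OF _ iv] insert.hyps by (simp add: UNIV_bool mult.commute)
  also have "\<dots> \<le> r * r ^ card C"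
    using insert.IH insert.prems by (intro mult_mono) (auto simp: pairwise_insert)
  finally show ?case
    using insert.hyps by simp
qed

text \<open>The mean of the infimum is at most the mean of the \<open>n\<close>-th sum, which is at
  most \<open>K ^ n * r ^ Suc n\<close> and hence tends to 0.\<close>

lemma AE_chain_weights_vanish:
  fixes m :: real
  defines "K \<equiv> real (card {w \<in> grid. near (m + 1) (0 :: 'a) w})"
  assumes s: "L \<le> s" and k: "0 \<le> k" and m: "m = 2 * k + 1" and z: "z \<in> grid" and r: "0 \<le> r" "K * r \<le> 1 / 2" "r \<le> 1"
    and w: "\<And>z. z \<in> grid \<Longrightarrow> (\<integral>\<^sup>+\<xi>. cell_weight s k J q z \<xi> \<partial>P) \<le> ennreal r"
  shows "AE \<xi> in P. (INF n. \<Sum>C\<in>far_chains m n z. \<Prod>c\<in>C. cell_weight s k J q c \<xi>) = 0"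
proof -
  have s0: "0 < s" and m0: "0 \<le> m"
    using s L_pos k m by auto
  define g where "g n \<xi> = (\<Sum>C\<in>far_chains m n z. \<Prod>c\<in>C. cell_weight s k J q c \<xi>)" for n \<xi>
  have meas: "cell_weight s k J q c \<in> borel_measurable P" for c
    using measurable_cell_weight[OF s0] by (simp add: measurable_cong_sets[OF sets_P])
  then have [measurable]: "g n \<in> borel_measurable P" for n
    unfolding g_def[abs_def] by measurable
  have "(\<integral>\<^sup>+\<xi>. (INF n. g n \<xi>) \<partial>P) \<le> ennreal ((1 / 2) ^ n)" for n
  proof -
    have "(\<integral>\<^sup>+\<xi>. (INF n. g n \<xi>) \<partial>P) \<le> (\<integral>\<^sup>+\<xi>. g n \<xi> \<partial>P)"
      by (intro nn_integral_mono INF_lower) simp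
    also have "\<dots> = (\<Sum>C\<in>far_chains m n z. \<integral>\<^sup>+\<xi>. (\<Prod>c\<in>C. cell_weight s k J q c \<xi>) \<partial>P)"
      unfolding g_def using meas by (intro nn_integral_sum) measurable
    also have "\<dots> \<le> (\<Sum>C\<in>far_chains m n z. ennreal r ^ Suc n)"
    proof (rule sum_mono)
      fix C assume "C \<in> far_chains m n z"
      from far_chainsD[OF m0 z this] have C: "finite C" "card C = Suc n" "C \<subseteq> grid"
        "pairwise (\<lambda>a b. \<not> near (2 * k + 1) a b) C"
        by (auto simp: m)
      show "(\<integral>\<^sup>+\<xi>. (\<Prod>c\<in>C. cell_weight s k J q c \<xi>) \<partial>P) \<le> ennreal r ^ Suc n"
        using nn_integral_prod_cell_weight[OF s k C(1,4), of J q "ennreal r"] w C(2,3) by auto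
    qed
    also have "\<dots> = ennreal (real (card (far_chains m n z)) * r ^ Suc n)"
      using r by (simp add: ennreal_power[symmetric] ennreal_mult ennreal_of_nat_eq_real_of_nat
          del: power_Suc)
    also have "\<dots> \<le> ennreal ((1 / 2) ^ n)"
    proof (rule ennreal_leI)
      have "real (card (far_chains m n z)) \<le> K ^ n"
        unfolding K_def using card_far_chains[OF z, of m n] by (metis of_nat_le_iff of_nat_power)
      \<comment> \<open>A chain has \<open>n + 1\<close> cells but only \<open>n\<close> choices;
        the surplus factor is dropped using \<open>r \<le> 1\<close>.\<close>
      moreover have "r ^ Suc n \<le> r ^ n"
        using r by (intro power_decreasing) auto
      ultimately have "real (card (far_chains m n z)) * r ^ Suc n \<le> K ^ n * r ^ n"
        using r by (intro mult_mono) (auto simp: K_def)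
      also have "\<dots> = (K * r) ^ n"
        by (simp add: power_mult_distrib)
      also have "\<dots> \<le> (1 / 2) ^ n"
        using r by (intro power_mono) (auto simp: K_def)
      finally show "real (card (far_chains m n z)) * r ^ Suc n \<le> (1 / 2) ^ n" .
    qed
    finally show ?thesis .
  qed
  moreover have "(\<lambda>n. ennreal ((1 / 2) ^ n)) \<longlonglongrightarrow> ennreal 0"
    by (intro tendsto_ennrealI LIMSEQ_power_zero) simp
  ultimately have "(\<integral>\<^sup>+\<xi>. (INF n. g n \<xi>) \<partial>P) \<le> ennreal 0"
    by (intro LIMSEQ_le_const) auto
  then have "(\<integral>\<^sup>+\<xi>. (INF n. g n \<xi>) \<partial>P) = 0"
    by simp
  then have "AE \<xi> in P. (INF n. g n \<xi>) = 0"
    by (subst (asm) nn_integral_0_iff_AE) measurable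
  then show ?thesis
    by (simp add: g_def)
qed

end

section \<open>Percolation on the Delaunay triangulation\<close>

text \<open>An infinite cluster yields bad chains of every length from the cell of one of its
  points. For each starting cell this is a null event, and there are countably many cells.\<close>

lemma AE_perc_finite_clusters:
  fixes \<xi> :: "'a::euclidean_space set" and k :: real
  defines "k \<equiv> real (2 * DIM('a) + 2)"
  assumes s: "0 < s" and \<xi>: "locfin \<xi>" and t: "0 \<le> t" and c: "0 \<le> c"
    and w: "\<And>e. e \<in> DT_edges \<xi> \<Longrightarrow> 0 \<le> w e \<and> w e \<le> c"
    and zero: "\<And>z. z \<in> grid \<Longrightarrow>
      (INF n. \<Sum>C\<in>far_chains (2 * k + 1) n z. \<Prod>c'\<in>C. cell_weight s k J (2 ^ J * (t * c)) c' \<xi>) = 0"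
  shows "AE \<eta> in perc \<xi> w t. finite_clusters \<xi> \<eta>"
proof -
  let ?\<mu> = "perc \<xi> w t" and ?m = "2 * k + 1"
  let ?W = "\<lambda>C. \<Prod>c'\<in>C. cell_weight s k J (2 ^ J * (t * c)) c' \<xi>"
  have k: "0 \<le> k" and m: "0 \<le> ?m"
    by (auto simp: k_def)
  have "AE \<eta> in ?\<mu>. \<not> (\<forall>n. \<exists>C\<in>far_chains ?m n z. \<forall>c\<in>C. bad s k J \<xi> \<eta> c)" if z: "z \<in> grid" for z
  proof -
    let ?good = "\<lambda>C V. V \<in> sets ?\<mu> \<and> {\<eta> \<in> space ?\<mu>. \<forall>z\<in>C. bad s k J \<xi> \<eta> z} \<subseteq> V \<and>
      emeasure ?\<mu> V \<le> ?W C"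
    have "\<forall>C\<in>(\<Union>n. far_chains ?m n z). \<exists>V. ?good C V"
    proof
      fix C assume "C \<in> (\<Union>n. far_chains ?m n z)"
      then have "finite C" "pairwise (\<lambda>a b. \<not> near (2 * k + 1) a b) C"
        using far_chainsD[OF m z] by auto
      then show "\<exists>V. ?good C V"
        using perc_all_bad[where w = w and C = C and J = J, OF s \<xi> k t c w] unfolding Bex_def by simp
    qed
    from bchoice[OF this] obtain U where "\<forall>C\<in>(\<Union>n. far_chains ?m n z). ?good C (U C)"
      by (rule exE)
    then have U: "U C \<in> sets ?\<mu>" "{\<eta> \<in> space ?\<mu>. \<forall>z\<in>C. bad s k J \<xi> \<eta> z} \<subseteq> U C"
        "emeasure ?\<mu> (U C) \<le> ?W C" if "C \<in> far_chains ?m n z" for n C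
      using that by blast+
    \<comment> \<open>A measurable cover of the event that bad chains of every length start at
      \<open>z\<close>; its measure is below every \<open>n\<close>-th sum, hence below their
      infimum 0.\<close>
    define N where "N = (\<Inter>n. \<Union>C\<in>far_chains ?m n z. U C)"
    have N_sets: "(\<Union>C\<in>far_chains ?m n z. U C) \<in> sets ?\<mu>" for n
      using U by (intro sets.finite_UN finite_far_chains) auto
    have "emeasure ?\<mu> N \<le> (\<Sum>C\<in>far_chains ?m n z. ?W C)" for n
    proof -
      have "emeasure ?\<mu> N \<le> emeasure ?\<mu> (\<Union>C\<in>far_chains ?m n z. U C)"
        unfolding N_def by (intro emeasure_mono N_sets) blast
      also have "\<dots> \<le> (\<Sum>C\<in>far_chains ?m n z. emeasure ?\<mu> (U C))"
        using U by (intro emeasure_subadditive_finite finite_far_chains) auto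
      also have "\<dots> \<le> (\<Sum>C\<in>far_chains ?m n z. ?W C)"
        using U by (intro sum_mono) auto
      finally show ?thesis .
    qed
    then have "emeasure ?\<mu> N \<le> 0"
      unfolding zero[OF z, symmetric] by (intro INF_greatest)
    moreover have "N \<in> sets ?\<mu>"
      unfolding N_def using N_sets by blast
    ultimately have "N \<in> null_sets ?\<mu>"
      by (simp add: null_sets_def)
    then show ?thesis
    proof (rule AE_I')
      show "{\<eta> \<in> space ?\<mu>. \<not> \<not> (\<forall>n. \<exists>C\<in>far_chains ?m n z. \<forall>c\<in>C. bad s k J \<xi> \<eta> c)} \<subseteq> N"
        unfolding N_def using U by blast
    qed
  qed
  then have "AE \<eta> in ?\<mu>. \<forall>z\<in>grid. \<not> (\<forall>n. \<exists>C\<in>far_chains ?m n z. \<forall>c\<in>C. bad s k J \<xi> \<eta> c)"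
    by (simp add: AE_ball_countable[OF countable_grid])
  then show ?thesis
  proof (rule AE_mp, intro AE_I2 impI)
    fix \<eta> assume \<eta>: "\<forall>z\<in>grid. \<not> (\<forall>n. \<exists>C\<in>far_chains ?m n z. \<forall>c\<in>C. bad s k J \<xi> \<eta> c)"
    show "finite_clusters \<xi> \<eta>"
      unfolding finite_clusters_def
    proof (rule ballI, rule ccontr)
      fix x assume "x \<in> \<xi>" "infinite {y. (x, y) \<in> (open_rel \<xi> \<eta>)\<^sup>*}"
      then have "\<forall>n. \<exists>C\<in>far_chains ?m n (cell s x). \<forall>c\<in>C. bad s k J \<xi> \<eta> c"
        using infinite_cluster_chain[OF s m \<xi>, of x \<eta> _ J] by (simp add: k_def)
      then show False
        using \<eta> cell_in_grid by blast
    qed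
  qed
qed

section \<open>From fixed configurations to the random environment\<close>

lemma edge_cond_eq:
  assumes "x \<noteq> y"
  shows "edge_cond co \<omega> {x, y} = cond co \<omega> x y"
  unfolding edge_cond_def using assms by (intro the_equality) (auto simp: doubleton_eq_iff cond_def)

theorem theorem6p2:
  fixes M :: "'w measure" and hat :: "'w \<Rightarrow> 'a::euclidean_space set"
    and co :: "'w \<Rightarrow> 'a \<Rightarrow> 'a \<Rightarrow> real" and Cstar :: real
  assumes "prob_space M"
    and "hat \<in> measurable M NN"
    and "stationary (distr M NN hat)"
    and "finite_intensity (distr M NN hat)"
    and "\<forall>\<omega>\<in>space M. \<forall>x y. DT_edge (hat \<omega>) x y \<longrightarrow> 0 \<le> co \<omega> x y"
    and "finite_range_dep (distr M NN hat)"
    and "0 < Cstar"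
    and "AE \<omega> in M. \<forall>x y. DT_edge (hat \<omega>) x y \<longrightarrow> cond co \<omega> x y \<le> Cstar"
  shows "SEP M hat co"
proof -
  let ?P = "distr M NN hat"
  obtain L where "0 < L" "\<And>A B. A \<in> sets borel \<Longrightarrow> B \<in> sets borel \<Longrightarrow> (\<forall>a\<in>A. \<forall>b\<in>B. L \<le> dist a b) \<Longrightarrow>
      prob_space.indep_var ?P NN (\<lambda>\<xi>. \<xi> \<inter> A) NN (\<lambda>\<xi>. \<xi> \<inter> B)"
    using assms(6) by (auto simp: finite_range_dep_def)
  moreover have "prob_space ?P"
    by (rule prob_space.prob_space_distr[OF assms(1,2)])
  ultimately interpret finite_range_point_process ?P L
    using assms(3)
    by (intro finite_range_point_process.intro stationary_point_process.intro
        stationary_point_process_axioms.intro finite_range_point_process_axioms.intro) auto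
  show ?thesis
  proof (cases "prob {\<xi> \<in> Nsp. \<xi> \<inter> UNIV = {}} = 0")
    case False
    \<comment> \<open>The configuration is almost surely empty, so there are no clusters and any
      positive time, here 1, serves.\<close>
    then have "prob {\<xi> \<in> Nsp. \<xi> \<inter> UNIV = {}} = 1"
      using prob_empty_zero_one by blast
    then have "AE \<xi> in ?P. \<xi> \<in> {\<xi> \<in> Nsp. \<xi> \<inter> UNIV = {}}"
      by (rule AE_prob_1)
    then have "AE \<omega> in M. hat \<omega> = {}"
      using AE_distrD[OF assms(2)] by fastforce
    then show ?thesis
      unfolding SEP_def
      by (rule AE_mp) (auto intro!: AE_I2 exI[of _ 1] simp: finite_clusters_def)
  next
    case True
    define k where "k = real (2 * DIM('a) + 2)"
    define m where "m = 2 * k + 1"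
    define K where "K = real (card {w \<in> grid. near (m + 1) (0 :: 'a) w})"
    \<comment> \<open>Makes \<open>K * r \<le> 1 / 2\<close>, so the decay beats the number of
      chains, and keeps \<open>r \<le> 1\<close> even for \<open>K = 0\<close>.\<close>
    define r where "r = 1 / (2 * K + 2)"
    have K: "0 \<le> K"
      by (simp add: K_def)
    have r: "0 < r" "K * r \<le> 1 / 2" "r \<le> 1"
      using K by (auto simp: r_def field_simps)
    have k: "0 \<le> k"
      by (simp add: k_def)
    obtain s J q where sJq: "L \<le> s" "0 < q"
        "\<And>z. z \<in> grid \<Longrightarrow> (\<integral>\<^sup>+\<xi>. cell_weight s k J q z \<xi> \<partial>?P) \<le> ennreal r"
      using exists_small_cell_weight[OF True r(1), of k] by blast
    have s: "0 < s"
      using sJq(1) L_pos by simp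
    \<comment> \<open>Solves \<open>2 ^ J * (t * Cstar) = q\<close>; the resulting time is the same
      for all \<open>\<omega>\<close>.\<close>
    define t where "t = q / (2 ^ J * Cstar)"
    have t: "0 < t" "2 ^ J * (t * Cstar) = q"
      using sJq(2) assms(7) by (auto simp: t_def)
    have "AE \<xi> in ?P. \<forall>z\<in>grid. (INF n. \<Sum>C\<in>far_chains m n z. \<Prod>c\<in>C. cell_weight s k J q c \<xi>) = 0"
      using AE_chain_weights_vanish[OF sJq(1) k m_def _ less_imp_le[OF r(1)] _ r(3) sJq(3)] r(2)
      by (simp add: AE_ball_countable[OF countable_grid] K_def)
    \<comment> \<open>Only the points have been averaged; the conductances enter below, for each
      fixed \<open>\<omega>\<close>, through the bounds 0 and \<open>Cstar\<close>.\<close>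
    then have "AE \<omega> in M. \<forall>z\<in>grid. (INF n. \<Sum>C\<in>far_chains m n z. \<Prod>c\<in>C. cell_weight s k J q c (hat \<omega>)) = 0"
      by (rule AE_distrD[OF assms(2)])
    with assms(8) AE_space
    have "AE \<omega> in M. AE \<eta> in perc (hat \<omega>) (edge_cond co \<omega>) t. finite_clusters (hat \<omega>) \<eta>"
    proof eventually_elim
      case elim: (elim \<omega>)
      have "hat \<omega> \<in> space NN"
        using measurable_space[OF assms(2)] elim(2) by blast
      then have fin: "locfin (hat \<omega>)"
        by (simp add: Nsp_def)
      have w: "0 \<le> edge_cond co \<omega> e \<and> edge_cond co \<omega> e \<le> Cstar" if e: "e \<in> DT_edges (hat \<omega>)" for e
      proof -
        obtain x y where xy: "e = {x, y}" "DT_edge (hat \<omega>) x y"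
          using e unfolding DT_edges_def by blast
        then have "0 \<le> co \<omega> x y" "0 \<le> co \<omega> y x" "cond co \<omega> x y \<le> Cstar"
          using assms(5) elim(1,2) DT_edge_sym by blast+
        moreover have "edge_cond co \<omega> e = cond co \<omega> x y"
          using edge_cond_eq DT_edgeD[OF xy(2)] xy(1) by metis
        ultimately show ?thesis
          by (simp add: cond_def)
      qed
      show ?case
        by (rule AE_perc_finite_clusters[where J = J, OF s fin less_imp_le[OF t(1)] less_imp_le[OF assms(7)] w])
          (use elim(3) t(2) in \<open>simp_all add: m_def k_def\<close>)
    qed
    then show ?thesis
      unfolding SEP_def using t(1) by (auto elim!: eventually_mono)
  qed
qed

end
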